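(* Let $1<n_1<n-1$, $a_1,\dots,a_n\in(-1,1)$, $\vec{a}_1=(a_1,\dots,a_{n_1})'$, $\vec{a}_2=(a_{n_1+1},\dots,a_n)'$, $D=\mathrm{Diag}(1-a_1^2,\dots,1-a_n^2)$, and for $|\vartheta|\le 1$ let $$R_\vartheta=D+\begin{pmatrix}\vec{a}_1\vec{a}_1' & \vartheta\,\vec{a}_1\vec{a}_2'\\ \vartheta\,\vec{a}_2\vec{a}_1' & \vec{a}_2\vec{a}_2'\end{pmatrix}.$$ Then for every $\alpha>0$ and every $\vartheta$ with $|\vartheta|\le1$ the cumulative distribution function of the $\Gamma_n(\alpha,R_\vartheta)$-distribution is MTP$_2$ on $(0,\infty)^n$. Consequently, if $(X_1,\dots,X_n)$ has the $\Gamma_n(\alpha,R_\vartheta)$-distribution, then for all $0<x_i\le b_i$ $(i=1,\dots,n)$ and every nonempty proper subset $I\subset\{1,\dots,n\}$, with $A_i=\{X_i\le x_i\}$ and $B_i=\{X_i\le b_i\}$, $$\frac{P\left(\bigcap_{i=1}^n A_i\right)}{P\left(\bigcap_{i\in I}A_i\right)P\left(\bigcap_{i\notin I}A_i\right)}\ \ge\ \frac{P\left(\bigcap_{i=1}^n B_i\right)}{P\left(\bigcap_{i\in I}B_i\right)P\left(\bigcap_{i\notin I}B_i\right)}.$$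
   Context: For a non-singular $n\times n$ correlation matrix $R$ and $\alpha>0$, the $\Gamma_n(\alpha,R)$-distribution is the probability distribution on $(0,\infty)^n$ with Laplace transform $E\exp(-\sum_i t_iX_i)=|I_n+RT|^{-\alpha}$, $T=\mathrm{Diag}(t_1,\dots,t_n)$, $t_i\ge 0$ ($|\cdot|$ denotes the determinant), whenever such a distribution exists; for the matrices $R_\vartheta$ considered here it exists for all $\alpha>0$. An everywhere positive function $F$ on $(0,\infty)^n$ is MTP$_2$ if $F(\vec{x}\vee\vec{y})F(\vec{x}\wedge\vec{y})\ge F(\vec{x})F(\vec{y})$ for all $\vec{x},\vec{y}\in(0,\infty)^n$, where $\vee,\wedge$ are componentwise maximum and minimum. *)

theory Defs
  imports "HOL-Probability.Probability" "Jordan_Normal_Form.Determinant"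
begin

text \<open>Coordinates are numbered \<open>0, \<dots>, n - 1\<close>. Points of \<open>\<real>\<^sup>n\<close> are the elements of
  the product space \<open>\<Pi>\<^sub>M i\<in>{..<n}. borel\<close>, i.e. functions that are \<open>undefined\<close> outside
  \<open>{..<n}\<close>; matrices are \<open>n \<times> n\<close> matrices of the type \<open>real mat\<close>.\<close>

definition outer_prod :: "real Matrix.vec \<Rightarrow> real Matrix.vec \<Rightarrow> real Matrix.mat" where
  "outer_prod u v = Matrix.mat (dim_vec u) (dim_vec v) (\<lambda>(i, j). vec_index u i * vec_index v j)"

definition R_theta :: "nat \<Rightarrow> nat \<Rightarrow> (nat \<Rightarrow> real) \<Rightarrow> real \<Rightarrow> real Matrix.mat" where
  "R_theta n n1 a \<theta> =
    (let a1 = Matrix.vec n1 a;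
         a2 = Matrix.vec (n - n1) (\<lambda>i. a (n1 + i))
     in mat_diag n (\<lambda>i. 1 - (a i)\<^sup>2) +
        four_block_mat
          (outer_prod a1 a1) (\<theta> \<cdot>\<^sub>m outer_prod a1 a2)
          (\<theta> \<cdot>\<^sub>m outer_prod a2 a1) (outer_prod a2 a2))"

text \<open>\<open>is_mv_gamma n \<alpha> R \<mu>\<close>: \<open>\<mu>\<close> is the \<open>\<Gamma>\<^sub>n(\<alpha>, R)\<close>-distribution. Being concentrated on
  the open positive orthant is expressed almost surely. For a positive definite \<open>R\<close> and
  \<open>t \<ge> 0\<close> the determinant is positive, so the real power is the usual one.\<close>

definition is_mv_gamma ::
    "nat \<Rightarrow> real \<Rightarrow> real Matrix.mat \<Rightarrow> (nat \<Rightarrow> real) measure \<Rightarrow> bool" where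
  "is_mv_gamma n \<alpha> R \<mu> \<longleftrightarrow>
     prob_space \<mu> \<and>
     sets \<mu> = sets (\<Pi>\<^sub>M i\<in>{..<n}. (borel :: real measure)) \<and>
     (AE x in \<mu>. \<forall>i<n. 0 < x i) \<and>
     (\<forall>t. (\<forall>i<n. 0 \<le> t i) \<longrightarrow>
        (\<integral>x. exp (- (\<Sum>i<n. t i * x i)) \<partial>\<mu>) =
          Determinant.det (1\<^sub>m n + R * mat_diag n t) powr (- \<alpha>))"

definition joint_cdf :: "nat \<Rightarrow> (nat \<Rightarrow> real) measure \<Rightarrow> (nat \<Rightarrow> real) \<Rightarrow> real" where
  "joint_cdf n \<mu> x = measure \<mu> {y \<in> space \<mu>. \<forall>i<n. y i \<le> x i}"

definition pos_orthant :: "nat \<Rightarrow> (nat \<Rightarrow> real) set" where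
  "pos_orthant n = {..<n} \<rightarrow>\<^sub>E {0<..}"

definition MTP2 :: "nat \<Rightarrow> ((nat \<Rightarrow> real) \<Rightarrow> real) \<Rightarrow> bool" where
  "MTP2 n F \<longleftrightarrow>
     (\<forall>x\<in>pos_orthant n. 0 < F x) \<and>
     (\<forall>x\<in>pos_orthant n. \<forall>y\<in>pos_orthant n.
        F (\<lambda>i. max (x i) (y i)) * F (\<lambda>i. min (x i) (y i)) \<ge> F x * F y)"

end

theory Submission
  imports Defs
begin

text \<open>
  Write \<open>w\<^sub>i = 1 - a\<^sub>i\<^sup>2\<close> and \<open>u\<^sub>i(t) = a\<^sub>i\<^sup>2 t\<^sub>i / (1 + w\<^sub>i t\<^sub>i)\<close>, and let \<open>A\<close> and \<open>B\<close> be the sums of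
  the \<open>u\<^sub>i(t)\<close> over the first and the second block of indices. Up to a diagonal matrix, \<open>R\<^sub>\<theta>\<close> has
  rank two, so \<open>|I + R\<^sub>\<theta> T| = (\<Prod>i. 1 + w\<^sub>i t\<^sub>i) ((1 + A) (1 + B) - \<theta>\<^sup>2 A B)\<close> (lemma
  \<open>det_R_theta\<close>). The power \<open>- \<alpha>\<close> of the last factor is the Laplace transform, at \<open>(A, B)\<close>, of a
  pair \<open>(Y, Z)\<close> of correlated gamma variables, and \<open>(1 + w\<^sub>i t\<^sub>i)\<^sup>-\<^sup>\<alpha> exp (- u\<^sub>i(t) y)\<close> is the
  Laplace transform of a noncentral gamma distribution with noncentrality proportional to \<open>y\<close>.
  Hence \<open>\<Gamma>\<^sub>n(\<alpha>, R\<^sub>\<theta>)\<close> is a mixture: given \<open>(Y, Z)\<close> the coordinates are independent noncentral gamma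
  variables, those of the first block driven by \<open>Y\<close> and those of the second by \<open>Z\<close>. That the mixture
  really has the right distribution function is a uniqueness theorem for Laplace transforms
  (\<open>Laplace_determines_cdf_mixture\<close>).

  For \<open>\<theta>\<^sup>2 < 1\<close> put \<open>r = 1 - \<theta>\<^sup>2\<close>. The identity
  \<open>(1 + A) (1 + B) - \<theta>\<^sup>2 A B = ((1 + r A) (1 + r B) - \<theta>\<^sup>2) / r\<close> and the negative binomial series turn
  the law of \<open>(Y, Z)\<close> into a mixture over \<open>m\<close> of pairs of independent gamma variables of shape
  \<open>\<alpha> + m\<close> and scale \<open>r\<close>. Thus the distribution function is
  \<open>F(x) = \<Sum>m. p\<^sub>m \<phi>\<^sub>1(m, x) \<phi>\<^sub>2(m, x)\<close>, where \<open>\<phi>\<^sub>j(m, x)\<close> integrates over \<open>y\<close> the product of the gamma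
  density of shape \<open>\<alpha> + m\<close> and the noncentral gamma distribution functions of the \<open>j\<close>-th block. For
  \<open>\<theta>\<^sup>2 = 1\<close> the variables \<open>Y\<close> and \<open>Z\<close> coincide and \<open>F\<close> is a single integral of this kind.

  All the factors are totally positive of order two: the gamma density in \<open>(m, y)\<close>, the Poisson
  weights in \<open>(k, y)\<close>, and \<open>1(s \<le> x)\<close> in \<open>(s, x)\<close>. Products of such functions are MTP\<open>\<^sub>2\<close>, and
  integrating out one linearly ordered variable preserves the property, by the four functions
  inequality (\<open>four_functions_nn_integral\<close>). Applying it to the Poisson index, to \<open>y\<close> and finally to
  \<open>m\<close> gives the MTP\<open>\<^sub>2\<close> property of \<open>F\<close>, only ever integrating over one variable at a time.

  The inequality between the quotients follows by applying MTP\<open>\<^sub>2\<close> to \<open>(x\<^sub>I, \<infinity>)\<close> and \<open>(b\<^sub>I, c)\<close>: the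
  quotient \<open>F(x\<^sub>I, c) / F(x\<^sub>I, \<infinity>)\<close> decreases in \<open>x\<^sub>I\<close>, and the same holds for the complement of \<open>I\<close>
  (\<open>cdf_marginal_ratio_mono\<close>).
\<close>

section \<open>Total positivity and the four functions inequality\<close>

text \<open>For real numbers this is \<open>(c - a) (c - b) \<ge> 0\<close>, divided by \<open>c\<close>.\<close>

lemma ennreal_add_le_add_of_mult_le:
  fixes a b c d :: ennreal
  assumes "a \<le> c" "b \<le> c" "a * b \<le> c * d"
  shows "a + b \<le> c + d"
proof (cases "c = Orderings.top \<or> d = Orderings.top")
  case True
  then show ?thesis by auto
next
  case False
  then have "a \<noteq> Orderings.top" "b \<noteq> Orderings.top" using assms by (auto simp: top_unique)
  with False obtain x y z w where r: "a = ennreal x" "b = ennreal y" "c = ennreal z" "d = ennreal w"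
    "0 \<le> x" "0 \<le> y" "0 \<le> z" "0 \<le> w"
    by (metis ennreal_cases)
  have le: "x \<le> z" "y \<le> z" "x * y \<le> z * w"
    using assms r by (simp_all flip: ennreal_mult)
  have "x + y \<le> z + w"
  proof (cases "z = 0")
    case True
    with le r show ?thesis by auto
  next
    case False
    have "z * (x + y) \<le> z * z + x * y"
      using mult_nonneg_nonneg[of "z - x" "z - y"] le by (simp add: algebra_simps)
    also have "\<dots> \<le> z * (z + w)" using le by (simp add: algebra_simps)
    finally show ?thesis using False r by auto
  qed
  then show ?thesis using r by (simp flip: ennreal_plus)
qed

text \<open>The four functions inequality on a chain. The product of the two integrals is half the double
  integral of \<open>f1 s * f2 t + f1 t * f2 s\<close>, and after this symmetrisation the inequality holds
  pointwise: for \<open>s \<le> t\<close> both summands are at most \<open>f3 t * f4 s\<close>, and their product is at most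
  \<open>f3 t * f4 s * (f3 s * f4 t)\<close>.\<close>

lemma four_functions_nn_integral:
  fixes f1 f2 f3 f4 :: "'s::linorder \<Rightarrow> ennreal"
  assumes [measurable]: "f1 \<in> borel_measurable M" "f2 \<in> borel_measurable M"
    "f3 \<in> borel_measurable M" "f4 \<in> borel_measurable M"
  assumes le: "\<And>s t. f1 s * f2 t \<le> f3 (max s t) * f4 (min s t)"
  shows "(\<integral>\<^sup>+s. f1 s \<partial>M) * (\<integral>\<^sup>+s. f2 s \<partial>M) \<le> (\<integral>\<^sup>+s. f3 s \<partial>M) * (\<integral>\<^sup>+s. f4 s \<partial>M)"
proof -
  have sym: "f1 s * f2 t + f1 t * f2 s \<le> f3 s * f4 t + f3 t * f4 s" if "s \<le> t" for s t
  proof -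
    have "(f1 s * f2 t) * (f1 t * f2 s) = (f1 s * f2 s) * (f1 t * f2 t)" by (simp add: ac_simps)
    also have "\<dots> \<le> (f3 s * f4 s) * (f3 t * f4 t)"
      using mult_mono[OF le[of s s] le[of t t]] by simp
    finally have "(f1 s * f2 t) * (f1 t * f2 s) \<le> (f3 t * f4 s) * (f3 s * f4 t)"
      by (simp add: ac_simps)
    then have "f1 s * f2 t + f1 t * f2 s \<le> f3 t * f4 s + f3 s * f4 t"
      using le[of s t] le[of t s] that
      by (intro ennreal_add_le_add_of_mult_le) (simp_all add: max_def min_def split: if_splits)
    then show ?thesis by (simp add: ac_simps)
  qed
  have sym': "f1 s * f2 t + f1 t * f2 s \<le> f3 s * f4 t + f3 t * f4 s" for s t
    using sym[of s t] sym[of t s] by (cases "s \<le> t") (auto simp: ac_simps)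
  have dbl: "(\<integral>\<^sup>+s. \<integral>\<^sup>+t. g s * h t + g t * h s \<partial>M \<partial>M) = 2 * ((\<integral>\<^sup>+s. g s \<partial>M) * (\<integral>\<^sup>+s. h s \<partial>M))"
    if [measurable]: "g \<in> borel_measurable M" "h \<in> borel_measurable M" for g h :: "'s \<Rightarrow> ennreal"
    by (simp add: nn_integral_add nn_integral_cmult nn_integral_multc mult_2)
  have "2 * ((\<integral>\<^sup>+s. f1 s \<partial>M) * (\<integral>\<^sup>+s. f2 s \<partial>M)) \<le> 2 * ((\<integral>\<^sup>+s. f3 s \<partial>M) * (\<integral>\<^sup>+s. f4 s \<partial>M))"
    unfolding dbl[symmetric, OF assms(1,2)] dbl[symmetric, OF assms(3,4)]
    by (intro nn_integral_mono sym')
  moreover have "x \<le> y" if "2 * x \<le> 2 * y" for x y :: ennreal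
    using that by (cases x; cases y) (auto simp: ennreal_mult[symmetric] ennreal_mult_eq_top_iff top_unique simp flip: ennreal_numeral)
  ultimately show ?thesis by blast
qed

text \<open>Total positivity of order two, in the lattice form that the four functions inequality
  consumes; \<open>tp2I\<close> recovers it from the determinant form.\<close>

definition tp2 :: "('a::linorder \<Rightarrow> 'b::linorder \<Rightarrow> ennreal) \<Rightarrow> bool" where
  "tp2 K \<longleftrightarrow> (\<forall>x x' y y'. K x y * K x' y' \<le> K (max x x') (max y y') * K (min x x') (min y y'))"

lemma tp2D: "tp2 K \<Longrightarrow> K x y * K x' y' \<le> K (max x x') (max y y') * K (min x x') (min y y')"
  unfolding tp2_def by blast

lemma tp2I:
  assumes "\<And>x x' y y'. x \<le> x' \<Longrightarrow> y \<le> y' \<Longrightarrow> K x y' * K x' y \<le> K x y * K x' y'"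
  shows "tp2 K"
  unfolding tp2_def
proof (intro allI)
  fix x x' y y'
  show "K x y * K x' y' \<le> K (max x x') (max y y') * K (min x x') (min y y')"
    using assms[of x x' y y'] assms[of x' x y y'] assms[of x x' y' y] assms[of x' x y' y]
    by (cases "x \<le> x'"; cases "y \<le> y'") (auto simp: ac_simps max_def min_def)
qed

lemma tp2_swap: "tp2 K \<Longrightarrow> tp2 (\<lambda>x y. K y x)"
  unfolding tp2_def by blast

lemma tp2_scale: 
  assumes "tp2 K" shows "tp2 (\<lambda>x y. g x * (K x y * h y))"
proof -
  have *: "f (max u v) * f (min u v) = f u * f v" for f :: "'x::linorder \<Rightarrow> ennreal" and u v
    by (simp add: max_def min_def ac_simps)
  show ?thesis
    unfolding tp2_def
  proof (intro allI)
    fix x x' y y'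
    have "g x * (K x y * h y) * (g x' * (K x' y' * h y')) = (g x * g x') * (h y * h y') * (K x y * K x' y')"
      by (simp add: ac_simps)
    also have "\<dots> \<le> (g x * g x') * (h y * h y') * (K (max x x') (max y y') * K (min x x') (min y y'))"
      by (intro mult_left_mono tp2D assms) auto
    also have "\<dots> = (g (max x x') * g (min x x')) * (h (max y y') * h (min y y')) * (K (max x x') (max y y') * K (min x x') (min y y'))"
      by (simp only: *)
    also have "\<dots> = g (max x x') * (K (max x x') (max y y') * h (max y y')) *
        (g (min x x') * (K (min x x') (min y y') * h (min y y')))"
      by (simp add: ac_simps)
    finally show "g x * (K x y * h y) * (g x' * (K x' y' * h y')) \<le> g (max x x') * (K (max x x') (max y y') * h (max y y')) *
        (g (min x x') * (K (min x x') (min y y') * h (min y y')))" .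
  qed
qed

text \<open>The basic composition formula of total positivity: in the lattice form it is the four functions
  inequality for the integration variable.\<close>

lemma tp2_compose:
  fixes M :: "'s::linorder measure"
  assumes [measurable]: "\<And>x. K x \<in> borel_measurable M" "\<And>y. (\<lambda>s. L s y) \<in> borel_measurable M"
  assumes K: "tp2 K" and L: "tp2 L"
  shows "tp2 (\<lambda>x y. \<integral>\<^sup>+s. K x s * L s y \<partial>M)"
  unfolding tp2_def
proof (intro allI, rule four_functions_nn_integral)
  fix x x' y y' s t
  have "K x s * L s y * (K x' t * L t y') = (K x s * K x' t) * (L s y * L t y')"
    by (simp add: ac_simps)
  also have "\<dots> \<le> (K (max x x') (max s t) * K (min x x') (min s t)) *
      (L (max s t) (max y y') * L (min s t) (min y y'))"
    by (intro mult_mono tp2D K L) auto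
  finally show "K x s * L s y * (K x' t * L t y') \<le> K (max x x') (max s t) * L (max s t) (max y y') *
     (K (min x x') (min s t) * L (min s t) (min y y'))"
    by (simp add: ac_simps)
qed measurable

text \<open>The source of all total positivity below: both the gamma densities and the Poisson weights
  are a multiple of \<open>y ^ m\<close> by a function of \<open>m\<close> and a function of \<open>y\<close>.\<close>

lemma tp2_power: "tp2 (\<lambda>(m::nat) y. ennreal (y ^ m) * indicator {0::real..} y)"
proof (rule tp2I)
  fix m m' :: nat and y y' :: real
  assume le: "m \<le> m'" "y \<le> y'"
  show "ennreal (y' ^ m) * indicator {0..} y' * (ennreal (y ^ m') * indicator {0..} y)
    \<le> ennreal (y ^ m) * indicator {0..} y * (ennreal (y' ^ m') * indicator {0..} y')"
  proof (cases "0 \<le> y")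
    case True
    then have "y' ^ m * y ^ m' = (y ^ m * y' ^ m) * y ^ (m' - m)"
      using le by (simp add: power_add[symmetric])
    also have "\<dots> \<le> (y ^ m * y' ^ m) * y' ^ (m' - m)"
      using True le by (intro mult_left_mono power_mono) auto
    also have "\<dots> = y ^ m * y' ^ m'"
      using le by (simp add: power_add[symmetric])
    finally show ?thesis using True le by (simp flip: ennreal_mult)
  qed simp
qed

lemma tp2_indicator_atMost: "tp2 (\<lambda>s x. indicator {..x} (s::real) :: ennreal)"
  by (rule tp2I) (auto simp: indicator_def)

section \<open>Gamma and noncentral gamma distributions\<close>

text \<open>Density of the gamma distribution with shape \<open>s\<close> and scale \<open>w\<close>.\<close>

definition gamma_dens :: "real \<Rightarrow> real \<Rightarrow> real \<Rightarrow> ennreal" where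
  "gamma_dens s w x = (if 0 < x then ennreal (x powr (s - 1) * exp (- x / w) / (w powr s * Gamma s)) else 0)"

lemma gamma_dens_measurable[measurable]: "gamma_dens s w \<in> borel_measurable borel"
  unfolding gamma_dens_def by measurable

lemma gamma_dens_nonpos[simp]: "x \<le> 0 \<Longrightarrow> gamma_dens s w x = 0"
  by (simp add: gamma_dens_def)

lemma gamma_dens_pos: "0 < x \<Longrightarrow> 0 < s \<Longrightarrow> 0 < w \<Longrightarrow> 0 < gamma_dens s w x"
  by (simp add: gamma_dens_def Gamma_real_pos)

text \<open>The exponential changes the rate from \<open>1 / w\<close> to \<open>c = 1 / w + t\<close>; rescaling by \<open>c\<close> leaves
  Euler's integral.\<close>

lemma nn_integral_gamma_dens_exp:
  assumes s: "0 < s" and w: "0 < w" and t: "0 < 1 + w * t"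
  shows "(\<integral>\<^sup>+x. gamma_dens s w x * ennreal (exp (- (t * x))) \<partial>lborel) = ennreal ((1 + w * t) powr (- s))"
proof -
  define c where "c = 1 / w + t"
  have c: "0 < c" using w t by (simp add: c_def field_simps)
  have cw: "c * w = 1 + w * t" using w by (simp add: c_def field_simps)
  have G: "0 < Gamma s" using s by (rule Gamma_real_pos)
  define C where "C = c powr (1 - s) / (w powr s * Gamma s)"
  have C0: "0 \<le> C" using G by (simp add: C_def)
  have "gamma_dens s w x * ennreal (exp (- (t * x))) =
      ennreal C * ennreal (indicator {0..} (c * x) * (c * x) powr (s - 1) / exp (c * x))"
    for x
  proof (cases "0 < x")
    case True
    have "c powr (1 - s) * c powr (s - 1) = 1"
      using c by (simp flip: powr_add)
    then have *: "x powr (s - 1) = c powr (1 - s) * (c * x) powr (s - 1)"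
      using c True by (simp add: powr_mult)
    have e: "exp (- x / w) * exp (- (t * x)) = 1 / exp (c * x)"
      using w by (simp add: c_def algebra_simps exp_minus flip: exp_add) (simp add: exp_minus inverse_eq_divide exp_add)
    have "x powr (s - 1) * exp (- x / w) / (w powr s * Gamma s) * exp (- (t * x)) =
       c powr (1 - s) * (c * x) powr (s - 1) * (exp (- x / w) * exp (- (t * x))) / (w powr s * Gamma s)"
      unfolding * by simp
    also have "\<dots> = C * ((c * x) powr (s - 1) / exp (c * x))"
      unfolding e C_def by simp
    finally have "x powr (s - 1) * exp (- x / w) / (w powr s * Gamma s) * exp (- (t * x)) =
       C * ((c * x) powr (s - 1) / exp (c * x))" .
    with True c show ?thesis
      by (simp add: gamma_dens_def ennreal_mult'[symmetric] ennreal_mult''[symmetric] C0 G less_imp_le)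
  next
    case False
    with c show ?thesis by (cases "x = 0") (auto simp: gamma_dens_def indicator_def zero_le_mult_iff)
  qed
  then have "(\<integral>\<^sup>+x. gamma_dens s w x * ennreal (exp (- (t * x))) \<partial>lborel) =
    ennreal C * (\<integral>\<^sup>+x. ennreal (indicator {0..} (c * x) * (c * x) powr (s - 1) / exp (c * x)) \<partial>lborel)"
    by (simp add: nn_integral_cmult)
  also have "(\<integral>\<^sup>+x. ennreal (indicator {0..} (c * x) * (c * x) powr (s - 1) / exp (c * x)) \<partial>lborel) =
    ennreal (1 / c) * (ennreal c * (\<integral>\<^sup>+x. ennreal (indicator {0..} (c * x) * (c * x) powr (s - 1) / exp (c * x)) \<partial>lborel))"
    using c by (simp add: mult.assoc[symmetric] ennreal_mult'[symmetric])
  also have "ennreal c * (\<integral>\<^sup>+x. ennreal (indicator {0..} (c * x) * (c * x) powr (s - 1) / exp (c * x)) \<partial>lborel) = Gamma s"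
    using nn_integral_real_affine[of "\<lambda>t. ennreal (indicator {0..} t * t powr (s - 1) / exp t)" c 0] c
    by (simp add: Gamma_conv_nn_integral_real[OF s])
  also have "ennreal C * (ennreal (1 / c) * ennreal (Gamma s)) = ennreal (C * (1 / c * Gamma s))"
    using C0 c G by (simp add: ennreal_mult'[symmetric])
  also have "C * (1 / c * Gamma s) = (1 + w * t) powr (- s)"
    using c w G unfolding C_def cw[symmetric] powr_minus
    by (simp add: powr_mult powr_diff field_simps)
  finally show ?thesis .
qed

lemma tp2_gamma_dens:
  assumes "0 < s" "0 < w"
  shows "tp2 (\<lambda>(m::nat) x. gamma_dens (s + real m) w x)"
proof -
  have "(\<lambda>(m::nat) x. gamma_dens (s + real m) w x) =
    (\<lambda>m x. ennreal (1 / (w powr (s + real m) * Gamma (s + real m))) *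
       ((ennreal (x ^ m) * indicator {0..} x) * ennreal (if 0 < x then x powr (s - 1) * exp (- x / w) else 0)))"
  proof (intro ext)
    fix m :: nat and x :: real
    have G: "0 < Gamma (s + real m)" using assms by (simp add: Gamma_real_pos)
    show "gamma_dens (s + real m) w x = ennreal (1 / (w powr (s + real m) * Gamma (s + real m))) *
       ((ennreal (x ^ m) * indicator {0..} x) * ennreal (if 0 < x then x powr (s - 1) * exp (- x / w) else 0))"
    proof (cases "0 < x")
      case True
      have "x powr (s + real m - 1) = x powr (s - 1) * x ^ m"
        using True by (simp add: powr_realpow[symmetric] powr_add[symmetric] algebra_simps)
      then show ?thesis
        using True G by (simp add: gamma_dens_def ennreal_mult''[symmetric] ennreal_mult'[symmetric] less_imp_le mult_ac)
    qed simp
  qed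
  then show ?thesis by (simp add: tp2_scale[OF tp2_power])
qed

text \<open>The weight is set to zero for negative \<open>y\<close>, where the formula would be alternating in \<open>k\<close>, so
  that total positivity holds on the whole real line.\<close>

definition poisson_weight :: "real \<Rightarrow> real \<Rightarrow> nat \<Rightarrow> ennreal" where
  "poisson_weight l y k = ennreal (exp (- (l * y)) * (l * y) ^ k / fact k) * indicator {0..} y"

lemma tp2_poisson_weight:
  assumes "0 \<le> l"
  shows "tp2 (poisson_weight l)"
proof -
  have "(\<lambda>k y. poisson_weight l y k) =
    (\<lambda>k y. ennreal (l ^ k / fact k) * ((ennreal (y ^ k) * indicator {0..} y) * ennreal (exp (- (l * y)))))"
    using assms
    by (intro ext) (auto simp: poisson_weight_def indicator_def power_mult_distrib
        ennreal_mult''[symmetric] ennreal_mult'[symmetric] mult_ac)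
  then have "tp2 (\<lambda>k y. poisson_weight l y k)" by (simp add: tp2_scale[OF tp2_power])
  then show ?thesis using tp2_swap by fastforce
qed

lemma poisson_weight_measurable[measurable]: "(\<lambda>y. poisson_weight l y k) \<in> borel_measurable borel"
  unfolding poisson_weight_def by measurable

text \<open>The noncentral gamma distribution: the shape is \<open>\<alpha>\<close> plus a Poisson variable of mean \<open>l * y\<close>.\<close>

definition nc_gamma_dens :: "real \<Rightarrow> real \<Rightarrow> real \<Rightarrow> real \<Rightarrow> real \<Rightarrow> ennreal" where
  "nc_gamma_dens \<alpha> w l y x = (\<integral>\<^sup>+k. poisson_weight l y k * gamma_dens (\<alpha> + real k) w x \<partial>count_space UNIV)"

definition nc_gamma_cdf :: "real \<Rightarrow> real \<Rightarrow> real \<Rightarrow> real \<Rightarrow> real \<Rightarrow> ennreal" where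
  "nc_gamma_cdf \<alpha> w l y x = (\<integral>\<^sup>+s. nc_gamma_dens \<alpha> w l y s * indicator {..x} s \<partial>lborel)"

lemma nc_gamma_dens_measurable:
  "(\<lambda>(y, x). nc_gamma_dens \<alpha> w l y x) \<in> borel_measurable (borel \<Otimes>\<^sub>M borel)"
  unfolding nc_gamma_dens_def nn_integral_count_space_nat by measurable

lemma nc_gamma_dens_measurable'[measurable (raw)]:
  assumes [measurable]: "f \<in> borel_measurable M" "g \<in> borel_measurable M"
  shows "(\<lambda>z. nc_gamma_dens \<alpha> w l (f z) (g z)) \<in> borel_measurable M"
  using measurable_compose[OF measurable_Pair[OF assms] nc_gamma_dens_measurable] by simp

lemma nc_gamma_cdf_measurable[measurable]:
  "(\<lambda>y. nc_gamma_cdf \<alpha> w l y x) \<in> borel_measurable borel"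
  unfolding nc_gamma_cdf_def by measurable

lemma nn_integral_nc_gamma_dens:
  assumes [measurable]: "f \<in> borel_measurable borel"
  shows "(\<integral>\<^sup>+x. nc_gamma_dens \<alpha> w l y x * f x \<partial>lborel) =
    (\<integral>\<^sup>+k. poisson_weight l y k * (\<integral>\<^sup>+x. gamma_dens (\<alpha> + real k) w x * f x \<partial>lborel) \<partial>count_space UNIV)"
  unfolding nc_gamma_dens_def nn_integral_count_space_nat
  by (simp add: nn_integral_suminf[symmetric] nn_integral_cmult[symmetric] ennreal_suminf_multc[symmetric] mult.assoc)

text \<open>Total positivity passes from the Poisson weights in \<open>(y, k)\<close>, through the gamma densities in
  \<open>(k, s)\<close>, to the indicator in \<open>(s, x)\<close>.\<close>

lemma tp2_nc_gamma_cdf: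
  assumes "0 < \<alpha>" "0 < w" "0 \<le> l"
  shows "tp2 (nc_gamma_cdf \<alpha> w l)"
proof -
  have "tp2 (\<lambda>k x. \<integral>\<^sup>+s. gamma_dens (\<alpha> + real k) w s * indicator {..x} s \<partial>lborel)"
    using assms by (intro tp2_compose[OF _ _ tp2_gamma_dens tp2_indicator_atMost]) simp_all
  then have "tp2 (\<lambda>y x. \<integral>\<^sup>+k. poisson_weight l y k * (\<integral>\<^sup>+s. gamma_dens (\<alpha> + real k) w s * indicator {..x} s \<partial>lborel) \<partial>count_space UNIV)"
    using assms by (intro tp2_compose[OF _ _ tp2_poisson_weight]) simp_all
  then show ?thesis
    by (simp add: nc_gamma_cdf_def[abs_def] nn_integral_nc_gamma_dens)
qed

lemma nc_gamma_dens_nonpos[simp]: "x \<le> 0 \<Longrightarrow> nc_gamma_dens \<alpha> w l y x = 0"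
  by (simp add: nc_gamma_dens_def)

lemma nn_integral_lborel_pos:
  fixes f :: "real \<Rightarrow> ennreal"
  assumes [measurable]: "f \<in> borel_measurable borel" and "0 < c" and pos: "\<And>s. 0 < s \<Longrightarrow> s \<le> c \<Longrightarrow> 0 < f s"
  shows "0 < (\<integral>\<^sup>+s. f s \<partial>lborel)"
proof (rule ccontr)
  assume "\<not> ?thesis"
  then have "(\<integral>\<^sup>+s. f s \<partial>lborel) = 0" by simp
  then have "AE s in lborel. f s = 0" by (subst (asm) nn_integral_0_iff_AE) measurable
  then have "AE s in lborel. s \<notin> {0<..c}"
    by (rule eventually_mono) (use pos in force)
  then have "emeasure lborel {0<..c} = 0"
    by (subst (asm) AE_iff_measurable[of "{0<..c}"]) auto
  then show False using \<open>0 < c\<close> by simp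
qed

lemma nc_gamma_dens_pos:
  assumes "0 < \<alpha>" "0 < w" "0 \<le> l" "0 < x" "0 < y"
  shows "0 < nc_gamma_dens \<alpha> w l y x"
proof -
  have "0 < poisson_weight l y 0 * gamma_dens (\<alpha> + real 0) w x"
    using assms by (auto simp: poisson_weight_def gamma_dens_pos ennreal_zero_less_mult_iff)
  also have "\<dots> \<le> nc_gamma_dens \<alpha> w l y x"
    unfolding nc_gamma_dens_def by (rule nn_integral_ge_point) auto
  finally show ?thesis .
qed

lemma nc_gamma_cdf_pos:
  assumes "0 < \<alpha>" "0 < w" "0 \<le> l" "0 < x" "0 < y"
  shows "0 < nc_gamma_cdf \<alpha> w l y x"
  unfolding nc_gamma_cdf_def using assms
  by (intro nn_integral_lborel_pos[of _ x]) (auto simp: nc_gamma_dens_pos ennreal_zero_less_mult_iff)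

text \<open>Each gamma component contributes \<open>(1 + w * t) powr (- \<alpha>) / (1 + w * t) ^ k\<close>, so the Poisson
  mixture sums to the exponential of a linear function of \<open>y\<close>. This is what lets a prescribed Laplace
  transform of the mixing variable appear.\<close>

lemma nn_integral_nc_gamma_dens_exp:
  assumes "0 < \<alpha>" "0 < w" "0 \<le> l" "0 \<le> y" "0 \<le> t"
  shows "(\<integral>\<^sup>+x. nc_gamma_dens \<alpha> w l y x * ennreal (exp (- (t * x))) \<partial>lborel) =
    ennreal ((1 + w * t) powr (- \<alpha>) * exp (- (l * w * t / (1 + w * t) * y)))"
proof -
  define p where "p = 1 + w * t"
  have p: "0 < p" using assms by (simp add: p_def add_pos_nonneg)
  have "(\<lambda>k. (l * y / p) ^ k / fact k) sums exp (l * y / p)"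
    using exp_converges[of "l * y / p"] by (simp add: divide_inverse mult.commute)
  then have S: "(\<lambda>k. exp (- (l * y)) * p powr (- \<alpha>) * ((l * y / p) ^ k / fact k)) sums
      (exp (- (l * y)) * p powr (- \<alpha>) * exp (l * y / p))"
    by (rule sums_mult)
  have "(\<integral>\<^sup>+x. nc_gamma_dens \<alpha> w l y x * ennreal (exp (- (t * x))) \<partial>lborel) =
    (\<Sum>k. poisson_weight l y k * ennreal (p powr (- (\<alpha> + real k))))"
    using assms p by (simp add: nn_integral_nc_gamma_dens nn_integral_gamma_dens_exp
        nn_integral_count_space_nat p_def)
  also have "\<dots> = (\<Sum>k. ennreal (exp (- (l * y)) * p powr (- \<alpha>) * ((l * y / p) ^ k / fact k)))"
  proof (rule suminf_cong)
    fix k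
    have "p powr (- (\<alpha> + real k)) = p powr (- \<alpha>) / p ^ k"
      using p by (simp add: powr_diff powr_realpow)
    then show "poisson_weight l y k * ennreal (p powr (- (\<alpha> + real k))) =
       ennreal (exp (- (l * y)) * p powr (- \<alpha>) * ((l * y / p) ^ k / fact k))"
      using assms p
      by (simp add: poisson_weight_def ennreal_mult'[symmetric] ennreal_mult''[symmetric] power_divide mult_ac)
  qed
  also have "\<dots> = ennreal (exp (- (l * y)) * p powr (- \<alpha>) * exp (l * y / p))"
    using assms p by (intro suminf_ennreal_eq S) auto
  also have "exp (- (l * y)) * p powr (- \<alpha>) * exp (l * y / p) = p powr (- \<alpha>) * exp (- (l * w * t / p * y))"
  proof -
    have "- (l * y) + l * y / p = - (l * w * t / p * y)"
      using p by (simp add: field_simps) (simp add: p_def algebra_simps)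
    then show ?thesis by (metis exp_add mult.assoc mult.commute)
  qed
  finally show ?thesis by (simp add: p_def)
qed

section \<open>Uniqueness of Laplace transforms\<close>

text \<open>With \<open>z = exp (- x)\<close> the values of the Laplace transform at the natural numbers are the
  moments of \<open>z\<close>, which lies in the unit interval, where polynomials are uniformly dense in the
  continuous functions.\<close>

lemma Laplace_integral_continuous:
  fixes M N :: "real measure" and g :: "real \<Rightarrow> real"
  assumes M: "finite_measure M" "sets M = sets borel" "AE x in M. 0 \<le> x"
    and N: "finite_measure N" "sets N = sets borel" "AE x in N. 0 \<le> x"
    and eq: "\<And>k::nat. (\<integral>\<^sup>+x. ennreal (exp (- (real k * x))) \<partial>M) = (\<integral>\<^sup>+x. ennreal (exp (- (real k * x))) \<partial>N)"
    and g: "continuous_on UNIV g"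
  shows "(\<integral>x. g (exp (- x)) \<partial>M) = (\<integral>x. g (exp (- x)) \<partial>N)"
proof -
  have bdd: "\<exists>B. \<forall>z\<in>{0..1}. \<bar>h z\<bar> \<le> B" if "continuous_on UNIV h" for h :: "real \<Rightarrow> real"
  proof -
    have "continuous_on {0..1} h" using that continuous_on_subset by blast
    then have "bounded (h ` {0..1})"
      by (intro compact_imp_bounded compact_continuous_image) auto
    then show ?thesis by (auto simp: bounded_iff)
  qed
  have intg: "integrable K (\<lambda>x. h (exp (- x)))"
    if K: "finite_measure K" "sets K = sets borel" "AE x in K. 0 \<le> x" and h: "continuous_on UNIV h"
    for K :: "real measure" and h :: "real \<Rightarrow> real"
  proof -
    interpret finite_measure K by fact
    note K(2)[measurable_cong]
    have [measurable]: "h \<in> borel_measurable borel"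
      using h by (rule borel_measurable_continuous_onI)
    obtain B where "\<forall>z\<in>{0..1}. \<bar>h z\<bar> \<le> B" using bdd[OF h] by blast
    then show ?thesis
      using K(3) by (intro integrable_const_bound[of _ B]) (auto elim!: eventually_mono)
  qed
  have pw: "(\<integral>x. exp (- x) ^ k \<partial>M) = (\<integral>x. exp (- x) ^ k \<partial>N)" for k
  proof -
    have "(\<integral>x. exp (- x) ^ k \<partial>K) = enn2real (\<integral>\<^sup>+x. ennreal (exp (- (real k * x))) \<partial>K)"
      if "sets K = sets borel" for K :: "real measure"
    proof -
      note that[measurable_cong]
      show ?thesis
        by (subst integral_eq_nn_integral) (auto simp: exp_of_nat_mult[symmetric] simp del: mult_minus_right)
    qed
    then show ?thesis using M N eq by simp
  qed
  have poly: "(\<integral>x. p (exp (- x)) \<partial>M) = (\<integral>x. p (exp (- x)) \<partial>N)" if rp: "real_polynomial_function p" for p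
  proof -
    obtain a n where p: "p = (\<lambda>x. \<Sum>i\<le>n. a i * x ^ i)"
      using rp unfolding real_polynomial_function_iff_sum by blast
    have i: "integrable M (\<lambda>x. exp (- x) ^ i)" "integrable N (\<lambda>x. exp (- x) ^ i)" for i
      by (rule intg[OF M, of "\<lambda>z. z ^ i"], intro continuous_intros)
        (rule intg[OF N, of "\<lambda>z. z ^ i"], intro continuous_intros)
    show ?thesis
      unfolding p by (simp add: i pw)
  qed
  (* the summand 1 keeps c positive when both measures vanish *)
  define c where "c = measure M (space M) + measure N (space N) + 1"
  have c: "0 < c" unfolding c_def by (simp add: add_nonneg_pos)
  have "\<bar>(\<integral>x. g (exp (- x)) \<partial>M) - (\<integral>x. g (exp (- x)) \<partial>N)\<bar> \<le> e" if e: "0 < e" for e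
  proof -
    obtain p where p: "real_polynomial_function p" "\<And>z. z \<in> {0..1} \<Longrightarrow> \<bar>g z - p z\<bar> < e / c"
      using Stone_Weierstrass_real_polynomial_function[of "{0..1}" g "e / c"] g e c continuous_on_subset
      by (metis compact_Icc divide_pos_pos subset_UNIV)
    have pc: "continuous_on UNIV p" 
      using p(1) by (simp add: continuous_on_polymonial_function real_polynomial_function_eq)
    have est: "\<bar>(\<integral>x. g (exp (- x)) \<partial>K) - (\<integral>x. p (exp (- x)) \<partial>K)\<bar> \<le> e / c * measure K (space K)"
      if K: "finite_measure K" "sets K = sets borel" "AE x in K. 0 \<le> x" for K
    proof -
      interpret finite_measure K by fact
      note ints = intg[OF K g] intg[OF K pc]
      have "\<bar>(\<integral>x. g (exp (- x)) \<partial>K) - (\<integral>x. p (exp (- x)) \<partial>K)\<bar> = \<bar>\<integral>x. g (exp (- x)) - p (exp (- x)) \<partial>K\<bar>"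
        using ints by simp
      also have "\<dots> \<le> (\<integral>x. \<bar>g (exp (- x)) - p (exp (- x))\<bar> \<partial>K)"
        by (rule integral_abs_bound)
      also have "\<dots> \<le> (\<integral>x. e / c \<partial>K)"
        using ints K(3) p(2)
        by (intro integral_mono_AE) (auto elim!: eventually_mono intro: less_imp_le)
      also have "\<dots> = e / c * measure K (space K)" by simp
      finally show ?thesis .
    qed
    have "\<bar>(\<integral>x. g (exp (- x)) \<partial>M) - (\<integral>x. g (exp (- x)) \<partial>N)\<bar> \<le>
       e / c * measure M (space M) + e / c * measure N (space N)"
      using est[OF M] est[OF N] poly[OF p(1)] by linarith
    also have "\<dots> \<le> e / c * c"
      unfolding distrib_left[symmetric] using e c by (intro mult_left_mono) (auto simp: c_def)
    finally show ?thesis using c by simp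
  qed
  then have "\<bar>(\<integral>x. g (exp (- x)) \<partial>M) - (\<integral>x. g (exp (- x)) \<partial>N)\<bar> \<le> 0"
    by (rule field_le_epsilon) auto
  then show ?thesis by simp
qed

text \<open>The indicator of \<open>x \<le> c\<close> is the indicator of \<open>exp (- x) \<ge> exp (- c)\<close>, hence a bounded limit of
  continuous functions of \<open>exp (- x)\<close>.\<close>

lemma Laplace_determines_atMost:
  fixes M N :: "real measure"
  assumes M: "finite_measure M" "sets M = sets borel" "AE x in M. 0 \<le> x"
    and N: "finite_measure N" "sets N = sets borel" "AE x in N. 0 \<le> x"
    and eq: "\<And>k::nat. (\<integral>\<^sup>+x. ennreal (exp (- (real k * x))) \<partial>M) = (\<integral>\<^sup>+x. ennreal (exp (- (real k * x))) \<partial>N)"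
  shows "emeasure M {..c} = emeasure N {..c}"
proof -
  (* a ramp of slope n that reaches 1 at z = exp (- c) *)
  define g where "g n z = max 0 (min 1 (1 + real n * (z - exp (- c))))" for n z
  have lim: "(\<lambda>n. g n (exp (- x))) \<longlonglongrightarrow> indicator {..c} x" for x
  proof (cases "x \<le> c")
    case True
    then have "g n (exp (- x)) = 1" for n by (simp add: g_def min_def max_def)
    with True show ?thesis by simp
  next
    case False
    then have d: "0 < exp (- c) - exp (- x)" by simp
    obtain k :: nat where k: "1 < real k * (exp (- c) - exp (- x))"
      using reals_Archimedean3[OF d] by blast
    have "\<forall>\<^sub>F n in sequentially. g n (exp (- x)) = 0"
      using eventually_ge_at_top[of k]
    proof eventually_elim
      case (elim n)
      have "real k * (exp (- c) - exp (- x)) \<le> real n * (exp (- c) - exp (- x))"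
        using elim d by (intro mult_right_mono) auto
      then have "1 + real n * (exp (- x) - exp (- c)) \<le> 0" using k by (simp add: algebra_simps)
      then show ?case by (simp add: g_def)
    qed
    then show ?thesis using False by (simp add: tendsto_eventually)
  qed
  have conv: "(\<lambda>n. \<integral>x. g n (exp (- x)) \<partial>K) \<longlonglongrightarrow> measure K {..c}"
    if "finite_measure K" "sets K = sets borel" for K
  proof -
    interpret finite_measure K by fact
    note that(2)[measurable_cong]
    have "(\<lambda>n. \<integral>x. g n (exp (- x)) \<partial>K) \<longlonglongrightarrow> (\<integral>x. indicator {..c} x \<partial>K)"
    proof (rule integral_dominated_convergence[where w="\<lambda>_. 1"])
      show "AE x in K. (\<lambda>i. g i (exp (- x))) \<longlonglongrightarrow> indicator {..c} x" using lim by simp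
      show "(\<lambda>x. g i (exp (- x))) \<in> borel_measurable K" for i unfolding g_def by measurable
      show "AE x in K. norm (g i (exp (- x))) \<le> 1" for i by (simp add: g_def)
    qed (auto simp: that(2))
    then show ?thesis using that(2) by simp
  qed
  have "(\<integral>x. g n (exp (- x)) \<partial>M) = (\<integral>x. g n (exp (- x)) \<partial>N)" for n
    unfolding g_def by (intro Laplace_integral_continuous[OF M N eq] continuous_intros)
  then have "measure M {..c} = measure N {..c}"
    using conv[OF M(1,2)] conv[OF N(1,2)] by (simp add: LIMSEQ_unique)
  then show ?thesis using M(1) N(1) by (simp add: finite_measure.emeasure_eq_measure)
qed

text \<open>Uniqueness of multivariate Laplace transforms, one side being a \<open>V\<close>-weighted mixture over \<open>Q\<close> of
  product laws with densities \<open>k i \<omega>\<close>. The exponential test functions are replaced by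
  indicators one coordinate at a time. For a single coordinate \<open>j\<close>, all other test functions being
  fixed, they act as a density, so that both sides are Laplace transforms of finite measures \<open>M\<close>
  and \<open>N\<close> on the line, and the one-dimensional result applies.\<close>

lemma Laplace_determines_cdf_mixture:
  fixes \<mu> :: "('i \<Rightarrow> real) measure" and Q :: "'q measure"
  assumes fin: "finite I"
    and mufin: "finite_measure \<mu>"
    and sets_mu[measurable_cong]: "sets \<mu> = sets (\<Pi>\<^sub>M i\<in>I. borel)"
    and pos: "AE x in \<mu>. \<forall>i\<in>I. 0 \<le> x i"
    and V[measurable]: "V \<in> borel_measurable Q"
    and k: "\<And>i. i \<in> I \<Longrightarrow> (\<lambda>(\<omega>, x). k i \<omega> x) \<in> borel_measurable (Q \<Otimes>\<^sub>M lborel)"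
    and kneg: "\<And>i \<omega> x. i \<in> I \<Longrightarrow> x < 0 \<Longrightarrow> k i \<omega> x = 0"
    and eq: "\<And>t. (\<And>i. i \<in> I \<Longrightarrow> 0 \<le> t i) \<Longrightarrow>
       (\<integral>\<^sup>+x. (\<Prod>i\<in>I. ennreal (exp (- (t i * x i)))) \<partial>\<mu>) =
       (\<integral>\<^sup>+\<omega>. V \<omega> * (\<Prod>i\<in>I. \<integral>\<^sup>+x. k i \<omega> x * ennreal (exp (- (t i * x))) \<partial>lborel) \<partial>Q)"
  shows "(\<integral>\<^sup>+x. (\<Prod>i\<in>I. indicator {..c i} (x i)) \<partial>\<mu>) =
       (\<integral>\<^sup>+\<omega>. V \<omega> * (\<Prod>i\<in>I. \<integral>\<^sup>+x. k i \<omega> x * indicator {..c i} x \<partial>lborel) \<partial>Q)"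
proof -
  define h :: "'i set \<Rightarrow> ('i \<Rightarrow> real) \<Rightarrow> ('i \<Rightarrow> real) \<Rightarrow> 'i \<Rightarrow> real \<Rightarrow> ennreal" where
    "h J c t i x = (if i \<in> J then indicator {..c i} x else ennreal (exp (- (t i * x))))" for J c t i x
  have h[measurable]: "h J c t i \<in> borel_measurable borel" for J c t i
    unfolding h_def by measurable
  have kk[measurable]: "k i \<omega> \<in> borel_measurable lborel" if "i \<in> I" "\<omega> \<in> space Q" for i \<omega>
    using measurable_compose[OF measurable_Pair1'[OF that(2)] k[OF that(1)]] by simp
  have k'[measurable]: "(\<lambda>z. k i (fst z) (snd z)) \<in> borel_measurable (Q \<Otimes>\<^sub>M lborel)" if "i \<in> I" for i
    using k[OF that] by (simp add: case_prod_beta')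
  have kint[measurable]: "(\<lambda>\<omega>. \<integral>\<^sup>+x. k i \<omega> x * h J c t i x \<partial>lborel) \<in> borel_measurable Q"
    if "i \<in> I" for i J c t
  proof -
    note k'[OF that, measurable]
    have "(\<lambda>z. k i (fst z) (snd z) * h J c t i (snd z)) \<in> borel_measurable (Q \<Otimes>\<^sub>M lborel)"
      by measurable
    then show ?thesis
      using lborel.borel_measurable_nn_integral[of "\<lambda>\<omega> x. k i \<omega> x * h J c t i x" Q]
      by (simp add: case_prod_beta')
  qed
  have "\<forall>c t. (\<forall>i\<in>I. 0 \<le> t i) \<longrightarrow> (\<integral>\<^sup>+x. (\<Prod>i\<in>I. h J c t i (x i)) \<partial>\<mu>) =
       (\<integral>\<^sup>+\<omega>. V \<omega> * (\<Prod>i\<in>I. \<integral>\<^sup>+x. k i \<omega> x * h J c t i x \<partial>lborel) \<partial>Q)"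
    if "J \<subseteq> I" for J
    using finite_subset[OF that fin] that
  proof (induction J rule: finite_induct)
    case empty
    then show ?case using eq by (simp add: h_def)
  next
    case (insert j J)
    then have j: "j \<in> I" "j \<notin> J" and J: "J \<subseteq> I" by auto
    show ?case
    proof (intro allI impI)
      fix c t :: "'i \<Rightarrow> real" assume t: "\<forall>i\<in>I. 0 \<le> t i"
      define W where "W x = (\<Prod>i\<in>I - {j}. h J c t i (x i))" for x
      define U where "U \<omega> = V \<omega> * (\<Prod>i\<in>I - {j}. \<integral>\<^sup>+x. k i \<omega> x * h J c t i x \<partial>lborel)" for \<omega>
      have splitW: "(\<Prod>i\<in>I. g i (x i)) = W x * g j (x j)"
        if "\<And>i. i \<in> I \<Longrightarrow> i \<noteq> j \<Longrightarrow> g i = h J c t i" for g x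
        using that by (simp add: prod.remove[OF fin j(1)] W_def mult.commute)
      have splitU: "V \<omega> * (\<Prod>i\<in>I. \<integral>\<^sup>+x. k i \<omega> x * g i x \<partial>lborel) = U \<omega> * (\<integral>\<^sup>+x. k j \<omega> x * g j x \<partial>lborel)"
        if "\<And>i. i \<in> I \<Longrightarrow> i \<noteq> j \<Longrightarrow> g i = h J c t i" for g \<omega>
        using that by (simp add: prod.remove[OF fin j(1)] U_def mult_ac)
      have [measurable]: "W \<in> borel_measurable \<mu>"
        unfolding W_def by measurable
      have [measurable]: "U \<in> borel_measurable Q"
        unfolding U_def by measurable
      have [measurable]: "(\<lambda>x. x j) \<in> borel_measurable \<mu>" using j by measurable
      define M where "M = distr (density \<mu> W) borel (\<lambda>x. x j)"
      define N where "N = distr (density (Q \<Otimes>\<^sub>M lborel) (\<lambda>(\<omega>, x). U \<omega> * k j \<omega> x)) borel snd"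
      have kj[measurable]: "(\<lambda>z. k j (fst z) (snd z)) \<in> borel_measurable (Q \<Otimes>\<^sub>M lborel)"
        using k[OF j(1)] by (simp add: case_prod_beta')
      have Mint: "(\<integral>\<^sup>+x. f x \<partial>M) = (\<integral>\<^sup>+x. W x * f (x j) \<partial>\<mu>)" if [measurable]: "f \<in> borel_measurable borel" for f
        unfolding M_def by (simp add: nn_integral_distr nn_integral_density)
      have Nint: "(\<integral>\<^sup>+x. f x \<partial>N) = (\<integral>\<^sup>+\<omega>. U \<omega> * (\<integral>\<^sup>+x. k j \<omega> x * f x \<partial>lborel) \<partial>Q)"
        if [measurable]: "f \<in> borel_measurable borel" for f
      proof -
        have "(\<integral>\<^sup>+x. f x \<partial>N) = (\<integral>\<^sup>+z. U (fst z) * k j (fst z) (snd z) * f (snd z) \<partial>(Q \<Otimes>\<^sub>M lborel))"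
          unfolding N_def by (simp add: nn_integral_distr nn_integral_density case_prod_beta')
        also have "\<dots> = (\<integral>\<^sup>+\<omega>. \<integral>\<^sup>+x. U \<omega> * k j \<omega> x * f x \<partial>lborel \<partial>Q)"
          by (subst lborel.nn_integral_fst[symmetric]) auto
        also have "\<dots> = (\<integral>\<^sup>+\<omega>. U \<omega> * (\<integral>\<^sup>+x. k j \<omega> x * f x \<partial>lborel) \<partial>Q)"
          using j by (intro nn_integral_cong) (simp add: nn_integral_cmult mult.assoc)
        finally show ?thesis .
      qed
      have Mexp: "(\<integral>\<^sup>+x. ennreal (exp (- (s * x))) \<partial>M) = (\<integral>\<^sup>+x. (\<Prod>i\<in>I. h J c (t(j := s)) i (x i)) \<partial>\<mu>)" for s
        unfolding Mint[of "\<lambda>x. ennreal (exp (- (s * x)))", simplified]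
        by (subst splitW) (auto simp: h_def fun_eq_iff j)
      have Nexp: "(\<integral>\<^sup>+x. ennreal (exp (- (s * x))) \<partial>N) =
         (\<integral>\<^sup>+\<omega>. V \<omega> * (\<Prod>i\<in>I. \<integral>\<^sup>+x. k i \<omega> x * h J c (t(j := s)) i x \<partial>lborel) \<partial>Q)" for s
        unfolding Nint[of "\<lambda>x. ennreal (exp (- (s * x)))", simplified]
        by (subst splitU) (auto simp: h_def fun_eq_iff j)
      have MN: "(\<integral>\<^sup>+x. ennreal (exp (- (s * x))) \<partial>M) = (\<integral>\<^sup>+x. ennreal (exp (- (s * x))) \<partial>N)" if "0 \<le> s" for s
      proof -
        have "\<forall>i\<in>I. 0 \<le> (t(j := s)) i" using t that by simp
        then show ?thesis
          unfolding Mexp Nexp using insert.IH[OF J] by blast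
      qed
      have finM: "emeasure M (space M) < Orderings.top"
      proof -
        have "emeasure M (space M) = (\<integral>\<^sup>+x. W x * 1 \<partial>\<mu>)"
          using Mint[of "\<lambda>_. 1"] by simp
        also have "\<dots> \<le> (\<integral>\<^sup>+x. 1 \<partial>\<mu>)"
        proof (rule nn_integral_mono_AE)
          show "AE x in \<mu>. W x * 1 \<le> 1"
            using pos
          proof eventually_elim
            case (elim x)
            have "h J c t i (x i) \<le> 1" if "i \<in> I" for i
              using elim that t by (auto simp: h_def indicator_def)
            then show ?case
              unfolding W_def using prod_mono_ennreal[of "I - {j}" "\<lambda>i. h J c t i (x i)" "\<lambda>_. 1"] by simp
          qed
        qed
        also have "\<dots> < Orderings.top" by (simp add: finite_measure.emeasure_finite[OF mufin] less_top[symmetric])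
        finally show ?thesis .
      qed
      have fM: "finite_measure M" using finM by (intro finite_measureI) auto
      have fN: "finite_measure N" using finM MN[of 0] by (intro finite_measureI) auto
      have pM: "AE x in M. 0 \<le> x"
        unfolding M_def using pos j by (subst AE_distr_iff) (auto simp: AE_density elim!: eventually_mono)
      have pN: "AE x in N. 0 \<le> x"
        unfolding N_def using kneg[OF j(1)]
        by (subst AE_distr_iff) (auto simp: AE_density not_less[symmetric] case_prod_beta' intro!: AE_I2)
      have "emeasure M {..c j} = emeasure N {..c j}"
        by (intro Laplace_determines_atMost fM fN pM pN MN) (auto simp: M_def N_def)
      then have "(\<integral>\<^sup>+x. indicator {..c j} x \<partial>M) = (\<integral>\<^sup>+x. indicator {..c j} x \<partial>N)"
        by (simp add: M_def N_def)
      then have "(\<integral>\<^sup>+x. W x * indicator {..c j} (x j) \<partial>\<mu>) = (\<integral>\<^sup>+\<omega>. U \<omega> * (\<integral>\<^sup>+x. k j \<omega> x * indicator {..c j} x \<partial>lborel) \<partial>Q)"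
        by (simp add: Mint Nint)
      also have "(\<integral>\<^sup>+x. W x * indicator {..c j} (x j) \<partial>\<mu>) = (\<integral>\<^sup>+x. (\<Prod>i\<in>I. h (insert j J) c t i (x i)) \<partial>\<mu>)"
        by (subst splitW) (auto simp: h_def fun_eq_iff j)
      also have "(\<integral>\<^sup>+\<omega>. U \<omega> * (\<integral>\<^sup>+x. k j \<omega> x * indicator {..c j} x \<partial>lborel) \<partial>Q) =
          (\<integral>\<^sup>+\<omega>. V \<omega> * (\<Prod>i\<in>I. \<integral>\<^sup>+x. k i \<omega> x * h (insert j J) c t i x \<partial>lborel) \<partial>Q)"
        by (subst splitU) (auto simp: h_def fun_eq_iff j)
      finally show "(\<integral>\<^sup>+x. (\<Prod>i\<in>I. h (insert j J) c t i (x i)) \<partial>\<mu>) =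
          (\<integral>\<^sup>+\<omega>. V \<omega> * (\<Prod>i\<in>I. \<integral>\<^sup>+x. k i \<omega> x * h (insert j J) c t i x \<partial>lborel) \<partial>Q)" .
    qed
  qed
  from this[of I] have "(\<integral>\<^sup>+x. (\<Prod>i\<in>I. h I c (\<lambda>_. 0) i (x i)) \<partial>\<mu>) =
       (\<integral>\<^sup>+\<omega>. V \<omega> * (\<Prod>i\<in>I. \<integral>\<^sup>+x. k i \<omega> x * h I c (\<lambda>_. 0) i x \<partial>lborel) \<partial>Q)"
    by simp
  then show ?thesis by (simp add: h_def cong: prod.cong)
qed

section \<open>The determinant\<close>

lemma det_2x2:
  fixes M :: "'a::comm_ring_1 mat"
  assumes "M \<in> carrier_mat 2 2"
  shows "Determinant.det M = M $$ (0,0) * M $$ (1,1) - M $$ (0,1) * M $$ (1,0)"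
proof -
  have "Determinant.det M = (\<Sum>i<2. M $$ (i,0) * cofactor M i 0)"
    using assms by (intro laplace_expansion_column) auto
  also have "\<dots> = M $$ (0,0) * M $$ (1,1) - M $$ (0,1) * M $$ (1,0)"
    using assms by (simp add: numeral_2_eq_2 cofactor_def mat_delete_def det_single)
  finally show ?thesis .
qed

text \<open>The matrix determinant lemma. The block matrix with rows \<open>E, U\<close> and \<open>- W, 1\<close> is made block
  triangular from the right in two ways, by clearing \<open>- W\<close> or by clearing \<open>U\<close>, each time with a
  unipotent factor.\<close>

lemma det_low_rank_update:
  fixes E F U W :: "'a::idom mat"
  assumes E: "E \<in> carrier_mat n n" and F: "F \<in> carrier_mat n n"
    and U: "U \<in> carrier_mat n m" and W: "W \<in> carrier_mat m n"
    and inv: "E * F = 1\<^sub>m n"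
  shows "Determinant.det (E + U * W) = Determinant.det E * Determinant.det (1\<^sub>m m + W * F * U)"
proof -
  let ?M = "four_block_mat E U (- W) (1\<^sub>m m)"
  let ?P = "four_block_mat (1\<^sub>m n) (0\<^sub>m n m) W (1\<^sub>m m)"
  let ?S = "four_block_mat (1\<^sub>m n) (- (F * U)) (0\<^sub>m m n) (1\<^sub>m m)"
  have M: "?M \<in> carrier_mat (n + m) (n + m)" and P: "?P \<in> carrier_mat (n + m) (n + m)"
    and S: "?S \<in> carrier_mat (n + m) (n + m)"
    using assms by auto
  have cU: "E * (F * U) = U" using assms by (simp add: assoc_mult_mat[symmetric, of _ n n _ n _ m])
  have "?M * ?P = four_block_mat (E * 1\<^sub>m n + U * W) (E * 0\<^sub>m n m + U * 1\<^sub>m m)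
      (- W * 1\<^sub>m n + 1\<^sub>m m * W) (- W * 0\<^sub>m n m + 1\<^sub>m m * 1\<^sub>m m)"
    using assms by (intro mult_four_block_mat) auto
  also have "\<dots> = four_block_mat (E + U * W) U (0\<^sub>m m n) (1\<^sub>m m)"
    using assms by (auto intro!: cong_four_block_mat eq_matI)
  finally have MP: "?M * ?P = four_block_mat (E + U * W) U (0\<^sub>m m n) (1\<^sub>m m)" .
  have "?M * ?S = four_block_mat (E * 1\<^sub>m n + U * 0\<^sub>m m n) (E * (- (F * U)) + U * 1\<^sub>m m)
      (- W * 1\<^sub>m n + 1\<^sub>m m * 0\<^sub>m m n) (- W * (- (F * U)) + 1\<^sub>m m * 1\<^sub>m m)"
    using assms by (intro mult_four_block_mat) auto
  also have "E * (- (F * U)) = - U"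
    using cU assms by simp
  also have "- W * (- (F * U)) = W * F * U"
    using assms by (simp add: assoc_mult_mat[of _ m n _ n _ m])
  also have "four_block_mat (E * 1\<^sub>m n + U * 0\<^sub>m m n) (- U + U * 1\<^sub>m m)
      (- W * 1\<^sub>m n + 1\<^sub>m m * 0\<^sub>m m n) (W * F * U + 1\<^sub>m m * 1\<^sub>m m) =
      four_block_mat E (0\<^sub>m n m) (- W) (1\<^sub>m m + W * F * U)"
    using assms by (auto intro!: cong_four_block_mat eq_matI)
  finally have MS: "?M * ?S = four_block_mat E (0\<^sub>m n m) (- W) (1\<^sub>m m + W * F * U)" .
  have "Determinant.det ?P = 1" "Determinant.det ?S = 1"
    using assms
     by (subst det_four_block_mat_upper_right_zero[where n=n and m=m], auto)
       (subst det_four_block_mat_lower_left_zero[where n=n and m=m], auto)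
  then have "Determinant.det (?M * ?P) = Determinant.det (?M * ?S)"
    using det_mult[OF M P] det_mult[OF M S] by simp
  moreover have "Determinant.det (?M * ?P) = Determinant.det (E + U * W)"
    unfolding MP using assms by (subst det_four_block_mat_lower_left_zero[where n=n and m=m]) auto
  moreover have "Determinant.det (?M * ?S) = Determinant.det E * Determinant.det (1\<^sub>m m + W * F * U)"
    unfolding MS using assms by (subst det_four_block_mat_upper_right_zero[where n=n and m=m]) auto
  ultimately show ?thesis by simp
qed

lemma det_mat_diag:
  "Determinant.det (mat_diag n f) = (\<Prod>i<n. f i :: 'a::comm_ring_1)"
proof -
  have "Determinant.det (mat_diag n f) = prod_list (diag_mat (mat_diag n f))"
    by (rule det_upper_triangular[where n=n]) (auto simp: mat_diag_def)
  also have "\<dots> = (\<Prod>i<n. f i)"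
    by (simp add: diag_mat_def mat_diag_def prod.list_conv_set_nth atLeast0LessThan)
  finally show ?thesis .
qed

lemma R_theta_index:
  assumes "n1 \<le> n" "i < n" "j < n"
  shows "R_theta n n1 a \<theta> $$ (i, j) =
    (if i = j then 1 - (a i)\<^sup>2 else 0) + (if (i < n1) = (j < n1) then 1 else \<theta>) * (a i * a j)"
  using assms by (auto simp: R_theta_def Let_def mat_diag_def outer_prod_def)

lemma R_theta_carrier: "n1 \<le> n \<Longrightarrow> R_theta n n1 a \<theta> \<in> carrier_mat n n"
  by (auto simp: R_theta_def Let_def outer_prod_def)

text \<open>\<open>R\<^sub>\<theta>\<close> differs from a diagonal matrix by \<open>U K U\<^sup>T\<close>, where the two columns of \<open>U\<close> are the two blocks
  of \<open>a\<close> and \<open>K\<close> is the \<open>2 \<times> 2\<close> correlation matrix with entry \<open>\<theta>\<close>. The determinant reduces to that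
  of \<open>1 + K Diag(A, B)\<close>.\<close>

lemma det_R_theta:
  fixes a t :: "nat \<Rightarrow> real"
  assumes n1: "n1 \<le> n" and pos: "\<And>i. i < n \<Longrightarrow> 1 + (1 - (a i)\<^sup>2) * t i \<noteq> 0"
  defines "u \<equiv> \<lambda>i. (a i)\<^sup>2 * t i / (1 + (1 - (a i)\<^sup>2) * t i)"
  defines "A \<equiv> \<Sum>i<n1. u i" and "B \<equiv> \<Sum>i=n1..<n. u i"
  shows "Determinant.det (1\<^sub>m n + R_theta n n1 a \<theta> * mat_diag n t) =
    (\<Prod>i<n. 1 + (1 - (a i)\<^sup>2) * t i) * ((1 + A) * (1 + B) - \<theta>\<^sup>2 * A * B)"
proof -
  define p where "p i = 1 + (1 - (a i)\<^sup>2) * t i" for i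
  define U where "U = Matrix.mat n 2 (\<lambda>(i, r). if (i < n1) = (r = 0) then a i else 0)"
  define W where "W = Matrix.mat 2 n (\<lambda>(r, j). (if (j < n1) = (r = 0) then 1 else \<theta>) * (a j * t j))"
  have U: "U \<in> carrier_mat n 2" and W: "W \<in> carrier_mat 2 n" by (auto simp: U_def W_def)
  let ?E = "mat_diag n p" and ?F = "mat_diag n (\<lambda>i. 1 / p i)"
  have eq: "1\<^sub>m n + R_theta n n1 a \<theta> * mat_diag n t = ?E + U * W"
  proof (rule eq_matI)
    fix i j assume "i < dim_row (?E + U * W)" "j < dim_col (?E + U * W)"
    then have ij: "i < n" "j < n" by (auto simp: U_def W_def)
    then show "(1\<^sub>m n + R_theta n n1 a \<theta> * mat_diag n t) $$ (i, j) = (?E + U * W) $$ (i, j)"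
      using R_theta_carrier[OF n1, of a \<theta>]
      by (simp add: mat_diag_mult_right[OF R_theta_carrier[OF n1]] R_theta_index[OF n1] U_def W_def p_def
          scalar_prod_def numeral_2_eq_2 mat_diag_def[of n p] algebra_simps power2_eq_square)
  qed (use R_theta_carrier[OF n1, of a \<theta>] in \<open>auto simp: U_def W_def mat_diag_def\<close>)
  have EF: "?E * ?F = 1\<^sub>m n"
    unfolding mat_diag_diag using pos by (auto simp: p_def mat_diag_def intro!: eq_matI)
  have WFU: "(W * ?F * U) $$ (r, q) = (if r = q then 1 else \<theta>) * (if q = 0 then A else B)"
    if "r < 2" "q < 2" for r q
  proof -
    have "(W * ?F * U) $$ (r, q) = (\<Sum>i<n. W $$ (r, i) * (1 / p i) * U $$ (i, q))"
      using that U W by (simp add: mat_diag_mult_right[OF W] scalar_prod_def atLeast0LessThan)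
    also have "\<dots> = (\<Sum>i<n. if (i < n1) = (q = 0) then (if r = q then 1 else \<theta>) * u i else 0)"
      using that by (intro sum.cong)
        (auto simp: U_def W_def u_def p_def power2_eq_square less_2_cases_iff)
    also have "\<dots> = (if r = q then 1 else \<theta>) * (\<Sum>i | i < n \<and> (i < n1) = (q = 0). u i)"
      by (subst sum.inter_filter[symmetric]) (auto simp: sum_distrib_left)
    also have "{i. i < n \<and> (i < n1) = (q = 0)} = (if q = 0 then {..<n1} else {n1..<n})"
      using n1 by auto
    finally show ?thesis by (simp add: A_def B_def split: if_splits)
  qed
  have "Determinant.det (1\<^sub>m 2 + W * ?F * U) = (1 + A) * (1 + B) - \<theta>\<^sup>2 * A * B"
  proof -
    define K where "K = W * ?F * U"
    have K: "K \<in> carrier_mat 2 2"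
      unfolding K_def using U W by (auto simp: mat_diag_def)
    have "K $$ (0, 0) = A" "K $$ (0, 1) = \<theta> * B" "K $$ (1, 0) = \<theta> * A" "K $$ (1, 1) = B"
      using WFU[of 0 0] WFU[of 0 1] WFU[of 1 0] WFU[of 1 1] by (simp_all add: K_def)
    then have "Determinant.det (1\<^sub>m 2 + K) = (1 + A) * (1 + B) - \<theta> * B * (\<theta> * A)"
      using K by (subst det_2x2) auto
    then show ?thesis by (simp add: K_def power2_eq_square mult_ac)
  qed
  then show ?thesis
    unfolding eq using det_low_rank_update[OF _ _ U W EF]
    by (simp add: det_mat_diag p_def)
qed

section \<open>Mixtures of blocks\<close>

lemma neg_binomial_sums:
  assumes "0 \<le> q" "q < (1::real)"
  shows "(\<lambda>m. pochhammer \<alpha> m / fact m * q ^ m) sums ((1 - q) powr (- \<alpha>))"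
proof -
  have "(- \<alpha> gchoose m) * (- q) ^ m = pochhammer \<alpha> m / fact m * q ^ m" for m
  proof -
    have "(- \<alpha> gchoose m) * (- q) ^ m = pochhammer \<alpha> m / fact m * ((- 1) ^ m * (- q) ^ m)"
      by (simp add: gbinomial_pochhammer)
    also have "(- 1) ^ m * (- q) ^ m = q ^ m"
      by (simp flip: power_mult_distrib)
    finally show ?thesis .
  qed
  then show ?thesis
    using gen_binomial_real[of "- q" "- \<alpha>"] assms by simp
qed

text \<open>Joint distribution function of the coordinates in \<open>S\<close> when they are driven by a common gamma
  variable of shape \<open>s\<close> and scale \<open>r\<close>.\<close>

definition block_cdf ::
    "real \<Rightarrow> ('i \<Rightarrow> real) \<Rightarrow> ('i \<Rightarrow> real) \<Rightarrow> 'i set \<Rightarrow> real \<Rightarrow> real \<Rightarrow> ('i \<Rightarrow> real) \<Rightarrow> ennreal" where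
  "block_cdf \<alpha> w l S s r x =
     (\<integral>\<^sup>+y. gamma_dens s r y * (\<Prod>i\<in>S. nc_gamma_cdf \<alpha> (w i) (l i) y (x i)) \<partial>lborel)"

lemma block_cdf_pos:
  assumes "finite S" "0 < \<alpha>" "\<And>i. i \<in> S \<Longrightarrow> 0 < w i \<and> 0 \<le> l i \<and> 0 < x i" "0 < s" "0 < r"
  shows "0 < block_cdf \<alpha> w l S s r x"
proof -
  have "0 < (\<Prod>i\<in>S. nc_gamma_cdf \<alpha> (w i) (l i) y (x i))" if "0 < y" for y
  proof -
    have "nc_gamma_cdf \<alpha> (w i) (l i) y (x i) \<noteq> 0" if "i \<in> S" for i
      using nc_gamma_cdf_pos[of \<alpha> "w i" "l i" "x i" y] assms(2) assms(3)[OF that] \<open>0 < y\<close> by auto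
    then have "(\<Prod>i\<in>S. nc_gamma_cdf \<alpha> (w i) (l i) y (x i)) \<noteq> 0"
      using assms(1) by simp
    then show ?thesis by (simp add: zero_less_iff_neq_zero)
  qed
  then show ?thesis
    unfolding block_cdf_def using assms
    by (intro nn_integral_lborel_pos[of _ 1]) (auto simp: gamma_dens_pos ennreal_zero_less_mult_iff)
qed

text \<open>The mixture index \<open>m\<close> enters only through the shape of the driving variable, and counts as one
  more coordinate of the MTP\<open>\<^sub>2\<close> function: a larger \<open>m\<close> favours larger \<open>y\<close>, and a larger \<open>y\<close> favours
  larger \<open>x i\<close>.\<close>

lemma block_cdf_mtp2:
  assumes "0 < \<alpha>" "\<And>i. i \<in> S \<Longrightarrow> 0 < w i \<and> 0 \<le> l i" "0 < r"
  shows "block_cdf \<alpha> w l S (\<alpha> + real m) r x * block_cdf \<alpha> w l S (\<alpha> + real m') r x' \<le>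
    block_cdf \<alpha> w l S (\<alpha> + real (max m m')) r (\<lambda>i. max (x i) (x' i)) *
    block_cdf \<alpha> w l S (\<alpha> + real (min m m')) r (\<lambda>i. min (x i) (x' i))"
  unfolding block_cdf_def
proof (rule four_functions_nn_integral)
  fix s t
  let ?g = "\<lambda>m y. gamma_dens (\<alpha> + real m) r y" and ?G = "\<lambda>i y x. nc_gamma_cdf \<alpha> (w i) (l i) y x"
  have "?g m s * (\<Prod>i\<in>S. ?G i s (x i)) * (?g m' t * (\<Prod>i\<in>S. ?G i t (x' i))) =
     (?g m s * ?g m' t) * (\<Prod>i\<in>S. ?G i s (x i) * ?G i t (x' i))"
    by (simp add: prod.distrib mult_ac)
  also have "\<dots> \<le> (?g (max m m') (max s t) * ?g (min m m') (min s t)) *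
     (\<Prod>i\<in>S. ?G i (max s t) (max (x i) (x' i)) * ?G i (min s t) (min (x i) (x' i)))"
    using assms
    by (intro mult_mono prod_mono_ennreal tp2D[OF tp2_gamma_dens] tp2D[OF tp2_nc_gamma_cdf]) auto
  also have "\<dots> = ?g (max m m') (max s t) * (\<Prod>i\<in>S. ?G i (max s t) (max (x i) (x' i))) *
     (?g (min m m') (min s t) * (\<Prod>i\<in>S. ?G i (min s t) (min (x i) (x' i))))"
    by (simp add: prod.distrib mult_ac)
  finally show "?g m s * (\<Prod>i\<in>S. ?G i s (x i)) * (?g m' t * (\<Prod>i\<in>S. ?G i t (x' i))) \<le>
    ?g (max m m') (max s t) * (\<Prod>i\<in>S. ?G i (max s t) (max (x i) (x' i))) *
     (?g (min m m') (min s t) * (\<Prod>i\<in>S. ?G i (min s t) (min (x i) (x' i))))" .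
qed measurable

text \<open>The weights drop out of the inequality, since \<open>p m * p m'\<close> is unchanged when \<open>m\<close> and \<open>m'\<close> are
  replaced by their maximum and minimum.\<close>

lemma two_block_mixture_mtp2:
  fixes p :: "nat \<Rightarrow> ennreal"
  assumes "0 < \<alpha>" "\<And>i. i \<in> S \<union> T \<Longrightarrow> 0 < w i \<and> 0 \<le> l i" "0 < r"
  defines "H \<equiv> \<lambda>x. \<integral>\<^sup>+m. p m * (block_cdf \<alpha> w l S (\<alpha> + real m) r x * block_cdf \<alpha> w l T (\<alpha> + real m) r x) \<partial>count_space UNIV"
  shows "H x * H x' \<le> H (\<lambda>i. max (x i) (x' i)) * H (\<lambda>i. min (x i) (x' i))"
  unfolding H_def
proof (rule four_functions_nn_integral)
  fix m m' :: nat
  let ?B = "\<lambda>S m. block_cdf \<alpha> w l S (\<alpha> + real m) r"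
  let ?u = "\<lambda>i. max (x i) (x' i)" and ?d = "\<lambda>i. min (x i) (x' i)"
  have "p m * (?B S m x * ?B T m x) * (p m' * (?B S m' x' * ?B T m' x')) =
    (p m * p m') * ((?B S m x * ?B S m' x') * (?B T m x * ?B T m' x'))"
    by (simp add: mult_ac)
  also have "\<dots> \<le> (p m * p m') *
     ((?B S (max m m') ?u * ?B S (min m m') ?d) * (?B T (max m m') ?u * ?B T (min m m') ?d))"
    using assms by (intro mult_left_mono mult_mono block_cdf_mtp2) auto
  also have "p m * p m' = p (max m m') * p (min m m')"
    by (simp add: max_def min_def mult_ac)
  finally show "p m * (?B S m x * ?B T m x) * (p m' * (?B S m' x' * ?B T m' x')) \<le>
     p (max m m') * (?B S (max m m') ?u * ?B T (max m m') ?u) *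
     (p (min m m') * (?B S (min m m') ?d * ?B T (min m m') ?d))"
    by (simp add: mult_ac)
qed auto

text \<open>Carrier of the index \<open>m\<close> and of the two driving variables; their joint law has the density
  \<open>mixing_dens\<close> with respect to it.\<close>

definition mixing_measure :: "(nat \<times> real \<times> real) measure" where
  "mixing_measure = count_space UNIV \<Otimes>\<^sub>M (lborel \<Otimes>\<^sub>M lborel)"

definition mixing_dens :: "(nat \<Rightarrow> ennreal) \<Rightarrow> real \<Rightarrow> real \<Rightarrow> nat \<times> real \<times> real \<Rightarrow> ennreal" where
  "mixing_dens p \<alpha> r = (\<lambda>(m, y, z). p m * (gamma_dens (\<alpha> + real m) r y * gamma_dens (\<alpha> + real m) r z))"

lemma mixing_dens_measurable[measurable]: "mixing_dens p \<alpha> r \<in> borel_measurable mixing_measure"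
  unfolding mixing_dens_def mixing_measure_def
  by (rule measurable_pair_measure_countable1) auto

lemma mixing_measure_measurable[measurable]:
  "(\<lambda>\<omega>. fst (snd \<omega>)) \<in> borel_measurable mixing_measure"
  "(\<lambda>\<omega>. snd (snd \<omega>)) \<in> borel_measurable mixing_measure"
  unfolding mixing_measure_def by measurable

lemma nn_integral_mixing:
  assumes [measurable]: "f \<in> borel_measurable borel" "g \<in> borel_measurable borel"
  shows "(\<integral>\<^sup>+\<omega>. mixing_dens p \<alpha> r \<omega> * (f (fst (snd \<omega>)) * g (snd (snd \<omega>))) \<partial>mixing_measure) =
    (\<integral>\<^sup>+m. p m * ((\<integral>\<^sup>+y. gamma_dens (\<alpha> + real m) r y * f y \<partial>lborel) *
       (\<integral>\<^sup>+z. gamma_dens (\<alpha> + real m) r z * g z \<partial>lborel)) \<partial>count_space UNIV)"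
proof -
  have sf: "sigma_finite_measure (lborel \<Otimes>\<^sub>M lborel :: (real \<times> real) measure)"
    by (simp add: lborel_prod lborel.sigma_finite_measure_axioms)
  have "(\<integral>\<^sup>+\<omega>. mixing_dens p \<alpha> r \<omega> * (f (fst (snd \<omega>)) * g (snd (snd \<omega>))) \<partial>mixing_measure) =
    (\<integral>\<^sup>+m. \<integral>\<^sup>+yz. mixing_dens p \<alpha> r (m, yz) * (f (fst yz) * g (snd yz)) \<partial>(lborel \<Otimes>\<^sub>M lborel) \<partial>count_space UNIV)"
    unfolding mixing_measure_def
    by (subst sigma_finite_measure.nn_integral_fst[OF sf, symmetric]) (simp_all add: mixing_measure_def[symmetric])
  also have "\<dots> = (\<integral>\<^sup>+m. p m * ((\<integral>\<^sup>+y. gamma_dens (\<alpha> + real m) r y * f y \<partial>lborel) *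
       (\<integral>\<^sup>+z. gamma_dens (\<alpha> + real m) r z * g z \<partial>lborel)) \<partial>count_space UNIV)"
  proof (rule nn_integral_cong)
    fix m :: nat
    let ?d = "gamma_dens (\<alpha> + real m) r"
    have "(\<integral>\<^sup>+yz. mixing_dens p \<alpha> r (m, yz) * (f (fst yz) * g (snd yz)) \<partial>(lborel \<Otimes>\<^sub>M lborel)) =
      (\<integral>\<^sup>+y. \<integral>\<^sup>+z. (p m * (?d y * f y)) * (?d z * g z) \<partial>lborel \<partial>lborel)"
      by (subst lborel.nn_integral_fst[symmetric])
        (simp_all add: mixing_dens_def case_prod_beta' mult_ac)
    also have "\<dots> = p m * ((\<integral>\<^sup>+y. ?d y * f y \<partial>lborel) * (\<integral>\<^sup>+z. ?d z * g z \<partial>lborel))"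
      by (simp add: nn_integral_cmult mult.assoc) (simp add: nn_integral_multc flip: mult.assoc)
    finally show "(\<integral>\<^sup>+yz. mixing_dens p \<alpha> r (m, yz) * (f (fst yz) * g (snd yz)) \<partial>(lborel \<Otimes>\<^sub>M lborel)) =
      p m * ((\<integral>\<^sup>+y. ?d y * f y \<partial>lborel) * (\<integral>\<^sup>+z. ?d z * g z \<partial>lborel))" .
  qed
  finally show ?thesis .
qed

definition neg_binomial_weight :: "real \<Rightarrow> real \<Rightarrow> nat \<Rightarrow> ennreal" where
  "neg_binomial_weight \<alpha> \<theta> m = ennreal ((1 - \<theta>\<^sup>2) powr \<alpha> * (pochhammer \<alpha> m / fact m * (\<theta>\<^sup>2) ^ m))"

text \<open>The bivariate gamma law as a negative binomial mixture of independent gamma pairs. With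
  \<open>r = 1 - \<theta>\<^sup>2\<close> and \<open>s = (1 + r A) (1 + r B)\<close>, the \<open>m\<close>-th pair has the transform \<open>s powr (- (\<alpha> + m))\<close>,
  the series sums to \<open>((s - \<theta>\<^sup>2) / r) powr (- \<alpha>)\<close>, and \<open>s - \<theta>\<^sup>2\<close> is divisible by \<open>r\<close>.\<close>

lemma nn_integral_mixing_exp:
  assumes \<alpha>: "0 < \<alpha>" and \<theta>: "\<theta>\<^sup>2 < 1" and AB: "0 \<le> A" "0 \<le> B"
  shows "(\<integral>\<^sup>+\<omega>. mixing_dens (neg_binomial_weight \<alpha> \<theta>) \<alpha> (1 - \<theta>\<^sup>2) \<omega> *
      (ennreal (exp (- (A * fst (snd \<omega>)))) * ennreal (exp (- (B * snd (snd \<omega>))))) \<partial>mixing_measure) =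
    ennreal (((1 + A) * (1 + B) - \<theta>\<^sup>2 * A * B) powr (- \<alpha>))"
proof -
  define r where "r = 1 - \<theta>\<^sup>2"
  have r: "0 < r" using \<theta> by (simp add: r_def)
  define s where "s = (1 + r * A) * (1 + r * B)"
  have pA: "1 \<le> 1 + r * A" and pB: "1 \<le> 1 + r * B" using r AB by auto
  have s: "1 \<le> s" unfolding s_def using mult_mono[OF pA pB] pA by simp
  define q where "q = \<theta>\<^sup>2 / s"
  have q: "0 \<le> q" "q < 1" using s \<theta> by (auto simp: q_def)
  have S: "(\<lambda>m. r powr \<alpha> * s powr (- \<alpha>) * (pochhammer \<alpha> m / fact m * q ^ m)) sums
      (r powr \<alpha> * s powr (- \<alpha>) * (1 - q) powr (- \<alpha>))"
    by (intro sums_mult neg_binomial_sums q)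
  have "(\<integral>\<^sup>+\<omega>. mixing_dens (neg_binomial_weight \<alpha> \<theta>) \<alpha> r \<omega> *
      (ennreal (exp (- (A * fst (snd \<omega>)))) * ennreal (exp (- (B * snd (snd \<omega>))))) \<partial>mixing_measure) =
    (\<Sum>m. neg_binomial_weight \<alpha> \<theta> m *
      (ennreal ((1 + r * A) powr (- (\<alpha> + real m))) * ennreal ((1 + r * B) powr (- (\<alpha> + real m)))))"
    using \<alpha> r pA pB
    by (subst nn_integral_mixing) (simp_all add: nn_integral_gamma_dens_exp nn_integral_count_space_nat)
  also have "\<dots> = (\<Sum>m. ennreal (r powr \<alpha> * s powr (- \<alpha>) * (pochhammer \<alpha> m / fact m * q ^ m)))"
  proof (rule suminf_cong)
    fix m
    have "(1 + r * A) powr (- (\<alpha> + real m)) * (1 + r * B) powr (- (\<alpha> + real m)) = s powr (- (\<alpha> + real m))"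
      using pA pB by (simp add: s_def powr_mult)
    also have "\<dots> = s powr (- \<alpha>) / s ^ m"
      using s by (simp add: powr_diff powr_realpow)
    finally have *: "ennreal ((1 + r * A) powr (- (\<alpha> + real m))) * ennreal ((1 + r * B) powr (- (\<alpha> + real m))) =
        ennreal (s powr (- \<alpha>) / s ^ m)"
      by (simp only: ennreal_mult'[OF powr_ge_zero, symmetric])
    have "0 \<le> pochhammer \<alpha> m" using \<alpha> by (rule pochhammer_nonneg)
    then show "neg_binomial_weight \<alpha> \<theta> m *
      (ennreal ((1 + r * A) powr (- (\<alpha> + real m))) * ennreal ((1 + r * B) powr (- (\<alpha> + real m)))) =
      ennreal (r powr \<alpha> * s powr (- \<alpha>) * (pochhammer \<alpha> m / fact m * q ^ m))"
      unfolding * using s by (simp add: ennreal_mult'[symmetric] neg_binomial_weight_def r_def[symmetric] q_def power_divide mult_ac)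
  qed
  also have "\<dots> = ennreal (r powr \<alpha> * s powr (- \<alpha>) * (1 - q) powr (- \<alpha>))"
    using pochhammer_nonneg[OF \<alpha>] q by (intro suminf_ennreal_eq S) auto
  also have "r powr \<alpha> * s powr (- \<alpha>) * (1 - q) powr (- \<alpha>) = ((1 / r) * s * (1 - q)) powr (- \<alpha>)"
    using r s q by (simp add: powr_mult powr_minus powr_divide) (simp add: inverse_eq_divide)
  also have "(1 / r) * s * (1 - q) = (s - \<theta>\<^sup>2) / r"
  proof -
    have "s * q = \<theta>\<^sup>2" using s by (simp add: q_def)
    then show ?thesis by (simp add: right_diff_distrib diff_divide_distrib)
  qed
  also have "s - \<theta>\<^sup>2 = r * ((1 + A) * (1 + B) - \<theta>\<^sup>2 * A * B)"
    unfolding s_def r_def by (simp add: algebra_simps power2_eq_square)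
  finally show ?thesis using r by (simp add: r_def[symmetric])
qed

section \<open>The distribution function as a mixture\<close>

lemma mv_gamma_nn_integral:
  assumes mu: "is_mv_gamma n \<alpha> R \<mu>" and t: "\<And>i. i < n \<Longrightarrow> 0 \<le> t i"
  shows "(\<integral>\<^sup>+x. (\<Prod>i<n. ennreal (exp (- (t i * x i)))) \<partial>\<mu>) =
    ennreal (Determinant.det (1\<^sub>m n + R * mat_diag n t) powr (- \<alpha>))"
proof -
  interpret prob_space \<mu> using mu by (simp add: is_mv_gamma_def)
  have sets[measurable_cong]: "sets \<mu> = sets (\<Pi>\<^sub>M i\<in>{..<n}. (borel :: real measure))"
    and pos: "AE x in \<mu>. \<forall>i<n. 0 < x i"
    using mu by (auto simp: is_mv_gamma_def)
  have prod: "(\<Prod>i<n. ennreal (exp (- (t i * x i)))) = ennreal (exp (- (\<Sum>i<n. t i * x i)))" for x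
    by (simp add: prod_ennreal exp_sum sum_negf[symmetric])
  have "integrable \<mu> (\<lambda>x. exp (- (\<Sum>i<n. t i * x i)))"
  proof (rule integrable_const_bound[where B=1])
    show "AE x in \<mu>. norm (exp (- (\<Sum>i<n. t i * x i))) \<le> 1"
      using pos by eventually_elim (auto intro!: sum_nonneg mult_nonneg_nonneg t simp: less_imp_le)
  qed measurable
  then have "(\<integral>\<^sup>+x. (\<Prod>i<n. ennreal (exp (- (t i * x i)))) \<partial>\<mu>) =
      ennreal (\<integral>x. exp (- (\<Sum>i<n. t i * x i)) \<partial>\<mu>)"
    unfolding prod by (intro nn_integral_eq_integral) auto
  also have "(\<integral>x. exp (- (\<Sum>i<n. t i * x i)) \<partial>\<mu>) = Determinant.det (1\<^sub>m n + R * mat_diag n t) powr (- \<alpha>)"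
    using mu t by (simp add: is_mv_gamma_def)
  finally show ?thesis .
qed

text \<open>Reduction to the driving variables: any weight \<open>V\<close> and any \<open>Y\<close> for which the Laplace transform
  of \<open>Y\<close> is the required function of the block sums represent the distribution function of
  \<open>\<Gamma>\<^sub>n(\<alpha>, R\<^sub>\<theta>)\<close>. Both the case of two driving variables and the degenerate one of a single driving
  variable are instances.\<close>

lemma mv_gamma_cdf_mixture:
  fixes a :: "nat \<Rightarrow> real" and Q :: "'q measure" and Y :: "nat \<Rightarrow> 'q \<Rightarrow> real"
  defines "w \<equiv> \<lambda>i. 1 - (a i)\<^sup>2" and "l \<equiv> \<lambda>i. (a i)\<^sup>2 / (1 - (a i)\<^sup>2)"
  assumes n1: "n1 \<le> n" and a: "\<And>i. i < n \<Longrightarrow> \<bar>a i\<bar> < 1" and \<alpha>: "0 < \<alpha>" and \<theta>: "\<theta>\<^sup>2 \<le> 1"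
    and mu: "is_mv_gamma n \<alpha> (R_theta n n1 a \<theta>) \<mu>"
    and V[measurable]: "V \<in> borel_measurable Q"
    and Y: "\<And>i. i < n \<Longrightarrow> Y i \<in> borel_measurable Q"
    and VY: "\<And>\<omega> i. i < n \<Longrightarrow> V \<omega> \<noteq> 0 \<Longrightarrow> 0 \<le> Y i \<omega>"
    and mix: "\<And>u. (\<And>i. i < n \<Longrightarrow> 0 \<le> u i) \<Longrightarrow>
      (\<integral>\<^sup>+\<omega>. V \<omega> * (\<Prod>i<n. ennreal (exp (- (u i * Y i \<omega>)))) \<partial>Q) =
      ennreal (((1 + (\<Sum>i<n1. u i)) * (1 + (\<Sum>i=n1..<n. u i)) - \<theta>\<^sup>2 * (\<Sum>i<n1. u i) * (\<Sum>i=n1..<n. u i)) powr (- \<alpha>))"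
  shows "emeasure \<mu> {y \<in> space \<mu>. \<forall>i<n. y i \<le> x i} =
    (\<integral>\<^sup>+\<omega>. V \<omega> * (\<Prod>i<n. nc_gamma_cdf \<alpha> (w i) (l i) (Y i \<omega>) (x i)) \<partial>Q)"
proof -
  interpret prob_space \<mu> using mu by (simp add: is_mv_gamma_def)
  have sets[measurable_cong]: "sets \<mu> = sets (\<Pi>\<^sub>M i\<in>{..<n}. (borel :: real measure))"
    and pos: "AE x in \<mu>. \<forall>i<n. 0 < x i"
    using mu by (auto simp: is_mv_gamma_def)
  have w: "0 < w i" and l: "0 \<le> l i" and lw: "l i * w i = (a i)\<^sup>2" if "i < n" for i
    using a[OF that] abs_square_less_1[of "a i"] by (auto simp: w_def l_def)
  have "(\<integral>\<^sup>+y. (\<Prod>i<n. indicator {..x i} (y i)) \<partial>\<mu>) =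
    (\<integral>\<^sup>+\<omega>. V \<omega> * (\<Prod>i<n. \<integral>\<^sup>+y. nc_gamma_dens \<alpha> (w i) (l i) (Y i \<omega>) y * indicator {..x i} y \<partial>lborel) \<partial>Q)"
  proof (rule Laplace_determines_cdf_mixture)
    show "finite_measure \<mu>" by (rule finite_measure_axioms)
    show "AE x in \<mu>. \<forall>i\<in>{..<n}. 0 \<le> x i" using pos by eventually_elim (auto intro: less_imp_le)
    show "(\<lambda>(\<omega>, y). nc_gamma_dens \<alpha> (w i) (l i) (Y i \<omega>) y) \<in> borel_measurable (Q \<Otimes>\<^sub>M lborel)"
      if "i \<in> {..<n}" for i
    proof -
      have [measurable]: "Y i \<in> borel_measurable Q" using that Y by auto
      show ?thesis by (simp add: case_prod_beta')
    qed
    fix t :: "nat \<Rightarrow> real" assume "\<And>i. i \<in> {..<n} \<Longrightarrow> 0 \<le> t i"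
    then have t: "0 \<le> t i" if "i < n" for i using that by auto
    define p where "p i = 1 + w i * t i" for i
    define u where "u i = (a i)\<^sup>2 * t i / p i" for i
    have p: "1 \<le> p i" if "i < n" for i using w[OF that] t[OF that] by (simp add: p_def)
    have u: "0 \<le> u i" if "i < n" for i using p[OF that] t[OF that] by (simp add: u_def)
    define A where "A = (\<Sum>i<n1. u i)"
    define B where "B = (\<Sum>i=n1..<n. u i)"
    have AB: "0 \<le> A" "0 \<le> B" unfolding A_def B_def using n1 by (auto intro!: sum_nonneg u)
    have AB': "0 \<le> (1 + A) * (1 + B) - \<theta>\<^sup>2 * A * B"
    proof -
      have "\<theta>\<^sup>2 * (A * B) \<le> 1 * (A * B)" using \<theta> AB by (intro mult_right_mono) auto
      then show ?thesis using AB by (simp add: algebra_simps)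
    qed
    have "(\<integral>\<^sup>+x. (\<Prod>i<n. ennreal (exp (- (t i * x i)))) \<partial>\<mu>) =
       ennreal (((\<Prod>i<n. p i) * ((1 + A) * (1 + B) - \<theta>\<^sup>2 * A * B)) powr (- \<alpha>))"
    proof -
      have "1 + (1 - (a i)\<^sup>2) * t i \<noteq> 0" if "i < n" for i
        using p[OF that] by (auto simp: p_def w_def)
      then show ?thesis
        using mv_gamma_nn_integral[OF mu, of t] t det_R_theta[OF n1, of a t \<theta>]
        by (simp add: A_def B_def p_def u_def w_def)
    qed
    also have "\<dots> = ennreal (\<Prod>i<n. p i powr (- \<alpha>)) * ennreal (((1 + A) * (1 + B) - \<theta>\<^sup>2 * A * B) powr (- \<alpha>))"
    proof -
      have "(\<Prod>i<n. p i) powr (- \<alpha>) = (\<Prod>i<n. p i powr (- \<alpha>))"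
        by (rule prod_powr_distrib)
      moreover have "0 \<le> (\<Prod>i<n. p i)" using p by (intro prod_nonneg) force
      ultimately show ?thesis
        using AB' by (simp add: powr_mult ennreal_mult'' )
    qed
    also have "\<dots> = (\<integral>\<^sup>+\<omega>. ennreal (\<Prod>i<n. p i powr (- \<alpha>)) * (V \<omega> * (\<Prod>i<n. ennreal (exp (- (u i * Y i \<omega>))))) \<partial>Q)"
    proof -
      have [measurable]: "(\<lambda>\<omega>. \<Prod>i<n. ennreal (exp (- (u i * Y i \<omega>)))) \<in> borel_measurable Q"
        using Y by measurable
      show ?thesis unfolding A_def B_def using u by (subst mix[symmetric]) (auto simp: nn_integral_cmult)
    qed
    also have "\<dots> = (\<integral>\<^sup>+\<omega>. V \<omega> * (\<Prod>i<n. \<integral>\<^sup>+x. nc_gamma_dens \<alpha> (w i) (l i) (Y i \<omega>) x * ennreal (exp (- (t i * x))) \<partial>lborel) \<partial>Q)"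
    proof (rule nn_integral_cong)
      fix \<omega>
      show "ennreal (\<Prod>i<n. p i powr (- \<alpha>)) * (V \<omega> * (\<Prod>i<n. ennreal (exp (- (u i * Y i \<omega>))))) =
        V \<omega> * (\<Prod>i<n. \<integral>\<^sup>+x. nc_gamma_dens \<alpha> (w i) (l i) (Y i \<omega>) x * ennreal (exp (- (t i * x))) \<partial>lborel)"
      proof (cases "V \<omega> = 0")
        case False
        have "(\<integral>\<^sup>+x. nc_gamma_dens \<alpha> (w i) (l i) (Y i \<omega>) x * ennreal (exp (- (t i * x))) \<partial>lborel) =
           ennreal (p i powr (- \<alpha>)) * ennreal (exp (- (u i * Y i \<omega>)))" if "i < n" for i
          using nn_integral_nc_gamma_dens_exp[OF \<alpha> w[OF that] l[OF that] VY[OF that False] t[OF that]]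
          by (simp add: lw[OF that] u_def p_def ennreal_mult')
        then show ?thesis by (simp add: prod.distrib prod_ennreal[symmetric] mult_ac)
      qed simp
    qed
    finally show "(\<integral>\<^sup>+x. (\<Prod>i<n. ennreal (exp (- (t i * x i)))) \<partial>\<mu>) =
      (\<integral>\<^sup>+\<omega>. V \<omega> * (\<Prod>i<n. \<integral>\<^sup>+x. nc_gamma_dens \<alpha> (w i) (l i) (Y i \<omega>) x * ennreal (exp (- (t i * x))) \<partial>lborel) \<partial>Q)" .
  qed (auto simp: sets)
  moreover have "(\<integral>\<^sup>+y. (\<Prod>i<n. indicator {..x i} (y i)) \<partial>\<mu>) = emeasure \<mu> {y \<in> space \<mu>. \<forall>i<n. y i \<le> x i}"
  proof -
    have "(\<integral>\<^sup>+y. (\<Prod>i<n. indicator {..x i} (y i)) \<partial>\<mu>) = (\<integral>\<^sup>+y. indicator {y \<in> space \<mu>. \<forall>i<n. y i \<le> x i} y \<partial>\<mu>)"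
    proof (rule nn_integral_cong)
      fix y assume "y \<in> space \<mu>"
      then show "(\<Prod>i<n. indicator {..x i} (y i)) = (indicator {y \<in> space \<mu>. \<forall>i<n. y i \<le> x i} y :: ennreal)"
        by (cases "\<forall>i<n. y i \<le> x i") (auto simp: indicator_def intro!: prod.neutral)
    qed
    also have "\<dots> = emeasure \<mu> {y \<in> space \<mu>. \<forall>i<n. y i \<le> x i}"
      by (rule nn_integral_indicator) measurable
    finally show ?thesis .
  qed
  ultimately show ?thesis by (simp add: nc_gamma_cdf_def)
qed

section \<open>The MTP2 property\<close>

text \<open>If \<open>\<theta>\<^sup>2 = 1\<close> all coordinates share one driving variable; otherwise each block has its own and
  the two are coupled through the index \<open>m\<close>.\<close>

lemma mv_gamma_cdf_mtp2:
  assumes n1: "n1 \<le> n" and a: "\<And>i. i < n \<Longrightarrow> \<bar>a i\<bar> < 1" and \<alpha>: "0 < \<alpha>" and \<theta>: "\<bar>\<theta>\<bar> \<le> 1"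
    and mu: "is_mv_gamma n \<alpha> (R_theta n n1 a \<theta>) \<mu>"
  shows joint_cdf_mtp2: "joint_cdf n \<mu> x * joint_cdf n \<mu> x' \<le>
      joint_cdf n \<mu> (\<lambda>i. max (x i) (x' i)) * joint_cdf n \<mu> (\<lambda>i. min (x i) (x' i))"
    and joint_cdf_pos: "(\<And>i. i < n \<Longrightarrow> 0 < x i) \<Longrightarrow> 0 < joint_cdf n \<mu> x"
proof -
  interpret prob_space \<mu> using mu by (simp add: is_mv_gamma_def)
  define w where "w i = 1 - (a i)\<^sup>2" for i
  define l where "l i = (a i)\<^sup>2 / (1 - (a i)\<^sup>2)" for i
  have wl: "0 < w i \<and> 0 \<le> l i" if "i < n" for i
    using a[OF that] abs_square_less_1[of "a i"] by (auto simp: w_def l_def)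
  have \<theta>2: "\<theta>\<^sup>2 \<le> 1" using \<theta> by (simp add: abs_square_le_1)
  have split: "(\<Prod>i<n. if i < n1 then f i else g i) = (\<Prod>i<n1. f i) * (\<Prod>i=n1..<n. g i)"
    for f g :: "nat \<Rightarrow> ennreal"
  proof -
    have *: "{..<n} = {..<n1} \<union> {n1..<n}" using n1 by auto
    show ?thesis unfolding * by (subst prod.union_disjoint) auto
  qed
  define H where "H x = emeasure \<mu> {y \<in> space \<mu>. \<forall>i<n. y i \<le> x i}" for x
  have "(\<forall>x x'. H x * H x' \<le> H (\<lambda>i. max (x i) (x' i)) * H (\<lambda>i. min (x i) (x' i))) \<and>
      (\<forall>x. (\<forall>i<n. 0 < x i) \<longrightarrow> 0 < H x)"
  proof (cases "\<theta>\<^sup>2 = 1")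
    case True
    have "H x = (\<integral>\<^sup>+y. gamma_dens \<alpha> 1 y * (\<Prod>i<n. nc_gamma_cdf \<alpha> (w i) (l i) y (x i)) \<partial>lborel)" for x
      unfolding H_def w_def l_def
    proof (rule mv_gamma_cdf_mixture[OF n1 a \<alpha> \<theta>2 mu])
      fix u :: "nat \<Rightarrow> real" assume u: "\<And>i. i < n \<Longrightarrow> 0 \<le> u i"
      define A where "A = (\<Sum>i<n1. u i)"
      define B where "B = (\<Sum>i=n1..<n. u i)"
      have AB: "0 \<le> A" "0 \<le> B" unfolding A_def B_def using n1 by (auto intro!: sum_nonneg u)
      have sum: "(\<Sum>i<n. u i) = A + B"
      proof -
        have *: "{..<n} = {..<n1} \<union> {n1..<n}" using n1 by auto
        show ?thesis unfolding * A_def B_def by (subst sum.union_disjoint) auto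
      qed
      have "(\<Prod>i<n. ennreal (exp (- (u i * y)))) = ennreal (exp (- ((A + B) * y)))" for y
        by (simp add: prod_ennreal exp_sum[symmetric] sum_negf sum_distrib_right[symmetric] sum)
      then have "(\<integral>\<^sup>+y. gamma_dens \<alpha> 1 y * (\<Prod>i<n. ennreal (exp (- (u i * y)))) \<partial>lborel) =
          ennreal ((1 + (A + B)) powr (- \<alpha>))"
        using nn_integral_gamma_dens_exp[of \<alpha> 1 "A + B"] \<alpha> AB by simp
      also have "1 + (A + B) = (1 + A) * (1 + B) - \<theta>\<^sup>2 * A * B"
        using True by (simp add: algebra_simps)
      finally show "(\<integral>\<^sup>+y. gamma_dens \<alpha> 1 y * (\<Prod>i<n. ennreal (exp (- (u i * y)))) \<partial>lborel) =
        ennreal (((1 + (\<Sum>i<n1. u i)) * (1 + (\<Sum>i=n1..<n. u i)) - \<theta>\<^sup>2 * (\<Sum>i<n1. u i) * (\<Sum>i=n1..<n. u i)) powr (- \<alpha>))"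
        by (simp add: A_def B_def)
    next
      fix \<omega> :: real assume "gamma_dens \<alpha> 1 \<omega> \<noteq> 0"
      then show "0 \<le> \<omega>" by (cases "0 \<le> \<omega>") auto
    qed auto
    then have H: "H x = block_cdf \<alpha> w l {..<n} (\<alpha> + real 0) 1 x" for x
      by (simp add: block_cdf_def)
    have "H x * H x' \<le> H (\<lambda>i. max (x i) (x' i)) * H (\<lambda>i. min (x i) (x' i))" for x x'
      unfolding H using block_cdf_mtp2[of \<alpha> "{..<n}" w l 1 0 x 0 x'] \<alpha> wl by simp
    moreover have "0 < H x" if "\<forall>i<n. 0 < x i" for x
      unfolding H using that \<alpha> wl by (intro block_cdf_pos) auto
    ultimately show ?thesis by blast
  next
    case False
    with \<theta>2 have \<theta>1: "\<theta>\<^sup>2 < 1" by simp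
    let ?r = "1 - \<theta>\<^sup>2" and ?p = "neg_binomial_weight \<alpha> \<theta>"
    define Y where "Y i \<omega> = (if i < n1 then fst (snd \<omega>) else snd (snd \<omega>))" for i :: nat and \<omega> :: "nat \<times> real \<times> real"
    have "H x = (\<integral>\<^sup>+\<omega>. mixing_dens ?p \<alpha> ?r \<omega> * (\<Prod>i<n. nc_gamma_cdf \<alpha> (w i) (l i) (Y i \<omega>) (x i)) \<partial>mixing_measure)" for x
      unfolding H_def w_def l_def
    proof (rule mv_gamma_cdf_mixture[OF n1 a \<alpha> \<theta>2 mu])
      show "Y i \<in> borel_measurable mixing_measure" for i unfolding Y_def by measurable
      fix u :: "nat \<Rightarrow> real" assume u: "\<And>i. i < n \<Longrightarrow> 0 \<le> u i"
      define A where "A = (\<Sum>i<n1. u i)"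
      define B where "B = (\<Sum>i=n1..<n. u i)"
      have AB: "0 \<le> A" "0 \<le> B" unfolding A_def B_def using n1 by (auto intro!: sum_nonneg u)
      have "(\<Prod>i<n. ennreal (exp (- (u i * Y i \<omega>)))) =
          (\<Prod>i<n. if i < n1 then ennreal (exp (- (u i * fst (snd \<omega>)))) else ennreal (exp (- (u i * snd (snd \<omega>)))))" for \<omega>
        by (intro prod.cong) (auto simp: Y_def)
      also have "\<dots> \<omega> = ennreal (exp (- (A * fst (snd \<omega>)))) * ennreal (exp (- (B * snd (snd \<omega>))))" for \<omega>
        unfolding split
        by (simp add: prod_ennreal exp_sum[symmetric] sum_negf sum_distrib_right[symmetric] A_def B_def)
      finally show "(\<integral>\<^sup>+\<omega>. mixing_dens ?p \<alpha> ?r \<omega> * (\<Prod>i<n. ennreal (exp (- (u i * Y i \<omega>)))) \<partial>mixing_measure) =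
        ennreal (((1 + (\<Sum>i<n1. u i)) * (1 + (\<Sum>i=n1..<n. u i)) - \<theta>\<^sup>2 * (\<Sum>i<n1. u i) * (\<Sum>i=n1..<n. u i)) powr (- \<alpha>))"
        using nn_integral_mixing_exp[OF \<alpha> \<theta>1 AB] by (simp add: A_def B_def)
    next
      fix \<omega> and i :: nat assume "mixing_dens ?p \<alpha> ?r \<omega> \<noteq> 0"
      then have "gamma_dens (\<alpha> + real (fst \<omega>)) ?r (fst (snd \<omega>)) \<noteq> 0"
          "gamma_dens (\<alpha> + real (fst \<omega>)) ?r (snd (snd \<omega>)) \<noteq> 0"
        by (auto simp: mixing_dens_def case_prod_beta')
      then have "0 \<le> fst (snd \<omega>)" "0 \<le> snd (snd \<omega>)"
        using gamma_dens_nonpos by (metis linear)+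
      then show "0 \<le> Y i \<omega>" by (simp add: Y_def)
    qed auto
    also have "(\<integral>\<^sup>+\<omega>. mixing_dens ?p \<alpha> ?r \<omega> * (\<Prod>i<n. nc_gamma_cdf \<alpha> (w i) (l i) (Y i \<omega>) (x i)) \<partial>mixing_measure) =
      (\<integral>\<^sup>+\<omega>. mixing_dens ?p \<alpha> ?r \<omega> * ((\<Prod>i<n1. nc_gamma_cdf \<alpha> (w i) (l i) (fst (snd \<omega>)) (x i)) *
         (\<Prod>i=n1..<n. nc_gamma_cdf \<alpha> (w i) (l i) (snd (snd \<omega>)) (x i))) \<partial>mixing_measure)" for x
      unfolding split[symmetric]
      by (intro nn_integral_cong arg_cong2[where f="(*)"] prod.cong) (auto simp: Y_def)
    also have "\<dots> x = (\<integral>\<^sup>+m. ?p m * (block_cdf \<alpha> w l {..<n1} (\<alpha> + real m) ?r x *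
         block_cdf \<alpha> w l {n1..<n} (\<alpha> + real m) ?r x) \<partial>count_space UNIV)" for x
      unfolding block_cdf_def
      by (rule nn_integral_mixing[of "\<lambda>y. \<Prod>i<n1. nc_gamma_cdf \<alpha> (w i) (l i) y (x i)"
            "\<lambda>y. \<Prod>i=n1..<n. nc_gamma_cdf \<alpha> (w i) (l i) y (x i)"]) measurable
    finally have H: "H x = (\<integral>\<^sup>+m. ?p m * (block_cdf \<alpha> w l {..<n1} (\<alpha> + real m) ?r x *
         block_cdf \<alpha> w l {n1..<n} (\<alpha> + real m) ?r x) \<partial>count_space UNIV)" for x .
    have "H x * H x' \<le> H (\<lambda>i. max (x i) (x' i)) * H (\<lambda>i. min (x i) (x' i))" for x x'
      unfolding H using \<alpha> wl n1 \<theta>1 by (intro two_block_mixture_mtp2) auto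
    moreover have "0 < H x" if x: "\<forall>i<n. 0 < x i" for x
    proof -
      have "0 < block_cdf \<alpha> w l {..<n1} (\<alpha> + real 0) ?r x" "0 < block_cdf \<alpha> w l {n1..<n} (\<alpha> + real 0) ?r x"
        using \<alpha> wl n1 \<theta>1 x by (auto intro!: block_cdf_pos)
      then have "0 < ?p 0 * (block_cdf \<alpha> w l {..<n1} (\<alpha> + real 0) ?r x * block_cdf \<alpha> w l {n1..<n} (\<alpha> + real 0) ?r x)"
        using \<theta>1 by (auto simp: neg_binomial_weight_def ennreal_zero_less_mult_iff)
      also have "\<dots> \<le> H x"
        unfolding H by (rule nn_integral_ge_point) auto
      finally show ?thesis .
    qed
    ultimately show ?thesis by blast
  qed
  moreover have "H x = ennreal (joint_cdf n \<mu> x)" for x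
    by (simp add: H_def joint_cdf_def emeasure_eq_measure)
  moreover have "0 \<le> joint_cdf n \<mu> x" for x by (simp add: joint_cdf_def)
  ultimately show "joint_cdf n \<mu> x * joint_cdf n \<mu> x' \<le>
      joint_cdf n \<mu> (\<lambda>i. max (x i) (x' i)) * joint_cdf n \<mu> (\<lambda>i. min (x i) (x' i))"
    and "(\<And>i. i < n \<Longrightarrow> 0 < x i) \<Longrightarrow> 0 < joint_cdf n \<mu> x"
    by (simp_all flip: ennreal_mult)
qed

section \<open>Marginal distribution functions\<close>

lemma marginal_cdf_limit:
  fixes X :: "nat \<Rightarrow> 'w \<Rightarrow> real"
  assumes "prob_space M" and X: "\<And>i. i < n \<Longrightarrow> X i \<in> borel_measurable M" and J: "J \<subseteq> {..<n}"
  shows "(\<lambda>N. measure M {\<omega> \<in> space M. \<forall>i<n. X i \<omega> \<le> (if i \<in> J then x i else real N)})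
     \<longlonglongrightarrow> measure M {\<omega> \<in> space M. \<forall>i\<in>J. X i \<omega> \<le> x i}"
proof -
  interpret prob_space M by fact
  let ?A = "\<lambda>N. {\<omega> \<in> space M. \<forall>i<n. X i \<omega> \<le> (if i \<in> J then x i else real N)}"
  have m: "?A N \<in> sets M" for N
  proof -
    have "?A N = {\<omega> \<in> space M. \<forall>i\<in>{..<n}. X i \<omega> \<le> (if i \<in> J then x i else real N)}" by auto
    also have "\<dots> \<in> sets M"
      by (rule sets.sets_Collect_finite_All) (use X in auto)
    finally show ?thesis .
  qed
  have "incseq ?A"
  proof (rule incseq_SucI, clarify)
    fix N \<omega> i assume *: "\<forall>i<n. X i \<omega> \<le> (if i \<in> J then x i else real N)" "i < n"
    show "X i \<omega> \<le> (if i \<in> J then x i else real (Suc N))"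
      using *(1)[rule_format, OF *(2)] by (simp split: if_splits)
  qed
  then have "(\<lambda>N. measure M (?A N)) \<longlonglongrightarrow> measure M (\<Union>N. ?A N)"
    by (intro finite_Lim_measure_incseq image_subsetI m)
  also have "(\<Union>N. ?A N) = {\<omega> \<in> space M. \<forall>i\<in>J. X i \<omega> \<le> x i}"
  proof (intro equalityI subsetI)
    fix \<omega> assume "\<omega> \<in> {\<omega> \<in> space M. \<forall>i\<in>J. X i \<omega> \<le> x i}"
    then have \<omega>: "\<omega> \<in> space M" "\<And>i. i \<in> J \<Longrightarrow> X i \<omega> \<le> x i" by auto
    obtain N where N: "(\<Sum>i<n. \<bar>X i \<omega>\<bar>) \<le> real N" using real_arch_simple by blast
    have "X i \<omega> \<le> real N" if "i < n" for i
    proof -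
      have "\<bar>X i \<omega>\<bar> \<le> (\<Sum>i<n. \<bar>X i \<omega>\<bar>)" using that by (intro member_le_sum) auto
      with N show ?thesis by simp
    qed
    with \<omega> show "\<omega> \<in> (\<Union>N. ?A N)" by auto
  next
    fix \<omega> assume "\<omega> \<in> (\<Union>N. ?A N)"
    then obtain N where N: "\<omega> \<in> space M" "\<And>i. i < n \<Longrightarrow> X i \<omega> \<le> (if i \<in> J then x i else real N)" by auto
    have "X i \<omega> \<le> x i" if "i \<in> J" for i using N(2)[of i] that J by auto
    with N(1) show "\<omega> \<in> {\<omega> \<in> space M. \<forall>i\<in>J. X i \<omega> \<le> x i}" by simp
  qed
  finally show ?thesis .
qed

text \<open>The MTP\<open>\<^sub>2\<close> inequality for the points \<open>(x\<^sub>J, N)\<close> and \<open>(b\<^sub>J, c)\<close>, whose maximum is \<open>(b\<^sub>J, N)\<close> and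
  whose minimum is \<open>(x\<^sub>J, c)\<close> as soon as \<open>N\<close> exceeds \<open>c\<close>; then \<open>N\<close> tends to infinity.\<close>

lemma cdf_marginal_ratio_mono:
  fixes X :: "nat \<Rightarrow> 'w \<Rightarrow> real"
  assumes M: "prob_space M" and X: "\<And>i. i < n \<Longrightarrow> X i \<in> borel_measurable M" and J: "J \<subseteq> {..<n}"
  defines "P \<equiv> \<lambda>I x. measure M {\<omega> \<in> space M. \<forall>i\<in>I. X i \<omega> \<le> x i}"
  assumes mtp2: "\<And>x y. P {..<n} x * P {..<n} y \<le> P {..<n} (\<lambda>i. max (x i) (y i)) * P {..<n} (\<lambda>i. min (x i) (y i))"
    and le: "\<And>i. i \<in> J \<Longrightarrow> x i \<le> b i"
  shows "P J x * P {..<n} (\<lambda>i. if i \<in> J then b i else c i) \<le>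
      P J b * P {..<n} (\<lambda>i. if i \<in> J then x i else c i)"
proof -
  let ?z = "\<lambda>y N i. if i \<in> J then y i else real N"
  let ?c = "\<lambda>y i. if i \<in> J then y i else c i"
  have lim: "(\<lambda>N. P {..<n} (?z y N)) \<longlonglongrightarrow> P J y" for y
    using marginal_cdf_limit[OF M X J, where x=y] by (simp add: P_def Ball_def)
  have cong: "P {..<n} y = P {..<n} z" if "\<And>i. i < n \<Longrightarrow> y i = z i" for y z
    using that by (simp add: P_def)
  (* from N0 on, real N dominates every coordinate of c *)
  obtain N0 where N0: "(\<Sum>i<n. \<bar>c i\<bar>) \<le> real N0" using real_arch_simple by blast
  have cN: "c i \<le> real N" if "i < n" "N0 \<le> N" for i N
  proof -
    have "\<bar>c i\<bar> \<le> (\<Sum>i<n. \<bar>c i\<bar>)" using that by (intro member_le_sum) auto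
    with N0 that(2) show ?thesis by linarith
  qed
  have "P {..<n} (?z x N) * P {..<n} (?c b) \<le> P {..<n} (?z b N) * P {..<n} (?c x)" if "N0 \<le> N" for N
  proof -
    have "P {..<n} (\<lambda>i. max (?z x N i) (?c b i)) = P {..<n} (?z b N)"
      using cN[OF _ that] le by (intro cong) (auto simp: max_def intro: order_antisym)
    moreover have "P {..<n} (\<lambda>i. min (?z x N i) (?c b i)) = P {..<n} (?c x)"
      using cN[OF _ that] le by (intro cong) (auto simp: min_def intro: order_antisym)
    ultimately show ?thesis using mtp2[of "?z x N" "?c b"] by simp
  qed
  then show ?thesis
    by (intro LIMSEQ_le[OF tendsto_mult_right[OF lim] tendsto_mult_right[OF lim]]) blast
qed

section \<open>Consequences for the multivariate gamma distribution\<close>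

theorem mainTheorem4:
  fixes n n1 :: nat and a :: "nat \<Rightarrow> real" and \<alpha> \<theta> :: real
  assumes "1 < n1" and "n1 < n - 1"
    and "\<And>i. i < n \<Longrightarrow> -1 < a i \<and> a i < 1"
    and "0 < \<alpha>" and "\<bar>\<theta>\<bar> \<le> 1"
  shows "(\<forall>\<mu>. is_mv_gamma n \<alpha> (R_theta n n1 a \<theta>) \<mu> \<longrightarrow> MTP2 n (joint_cdf n \<mu>)) \<and>
    (\<forall>(M :: 'w measure) (X :: nat \<Rightarrow> 'w \<Rightarrow> real).
       prob_space M \<and>
       (\<forall>i<n. X i \<in> borel_measurable M) \<and>
       is_mv_gamma n \<alpha> (R_theta n n1 a \<theta>)
         (distr M (\<Pi>\<^sub>M i\<in>{..<n}. borel) (\<lambda>\<omega>. \<lambda>i\<in>{..<n}. X i \<omega>)) \<longrightarrow>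
       (\<forall>(x :: nat \<Rightarrow> real) (b :: nat \<Rightarrow> real) I.
          (\<forall>i<n. 0 < x i \<and> x i \<le> b i) \<and> I \<noteq> {} \<and> I \<subset> {..<n} \<longrightarrow>
          (let A = (\<lambda>i. {\<omega> \<in> space M. X i \<omega> \<le> x i});
               B = (\<lambda>i. {\<omega> \<in> space M. X i \<omega> \<le> b i})
           in measure M (\<Inter>i<n. A i) /
                (measure M (\<Inter>i\<in>I. A i) * measure M (\<Inter>i\<in>{..<n} - I. A i))
              \<ge> measure M (\<Inter>i<n. B i) /
                (measure M (\<Inter>i\<in>I. B i) * measure M (\<Inter>i\<in>{..<n} - I. B i)))))"
proof -
  have n1: "n1 \<le> n" using assms(2) by simp
  have a: "\<bar>a i\<bar> < 1" if "i < n" for i using assms(3)[OF that] by auto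
  note mtp2 = joint_cdf_mtp2[OF n1 a assms(4,5)] and pos = joint_cdf_pos[OF n1 a assms(4,5)]
  have 1: "MTP2 n (joint_cdf n \<mu>)" if mu: "is_mv_gamma n \<alpha> (R_theta n n1 a \<theta>) \<mu>" for \<mu>
    unfolding MTP2_def using mtp2[OF _ mu] pos[OF _ mu] by (force simp: pos_orthant_def PiE_def Pi_def)
  have 2: "measure M (\<Inter>i<n. {\<omega> \<in> space M. X i \<omega> \<le> b i}) /
      (measure M (\<Inter>i\<in>I. {\<omega> \<in> space M. X i \<omega> \<le> b i}) * measure M (\<Inter>i\<in>{..<n} - I. {\<omega> \<in> space M. X i \<omega> \<le> b i})) \<le>
      measure M (\<Inter>i<n. {\<omega> \<in> space M. X i \<omega> \<le> x i}) /
      (measure M (\<Inter>i\<in>I. {\<omega> \<in> space M. X i \<omega> \<le> x i}) * measure M (\<Inter>i\<in>{..<n} - I. {\<omega> \<in> space M. X i \<omega> \<le> x i}))"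
    if M: "prob_space M" and X: "\<forall>i<n. X i \<in> borel_measurable M"
      and mu: "is_mv_gamma n \<alpha> (R_theta n n1 a \<theta>) (distr M (\<Pi>\<^sub>M i\<in>{..<n}. borel) (\<lambda>\<omega>. \<lambda>i\<in>{..<n}. X i \<omega>))"
      and x: "\<forall>i<n. 0 < x i \<and> x i \<le> b i" and I: "I \<noteq> {}" "I \<subset> {..<n}"
    for M :: "'w measure" and X x b I
  proof -
    interpret prob_space M by fact
    define P where "P J y = measure M {\<omega> \<in> space M. \<forall>i\<in>J. X i \<omega> \<le> y i}" for J y
    have X'[measurable]: "X i \<in> borel_measurable M" if "i < n" for i using X that by blast
    have "(\<lambda>\<omega>. \<lambda>i\<in>{..<n}. X i \<omega>) \<in> measurable M (\<Pi>\<^sub>M i\<in>{..<n}. borel)"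
      using X by (intro measurable_restrict) auto
    then have cdf: "joint_cdf n (distr M (\<Pi>\<^sub>M i\<in>{..<n}. borel) (\<lambda>\<omega>. \<lambda>i\<in>{..<n}. X i \<omega>)) y = P {..<n} y" for y
      unfolding joint_cdf_def P_def
      by (subst measure_distr) (auto simp: space_PiM intro!: arg_cong[where f="measure M"])
    have mtp2': "P {..<n} y * P {..<n} z \<le> P {..<n} (\<lambda>i. max (y i) (z i)) * P {..<n} (\<lambda>i. min (y i) (z i))" for y z
      using mtp2[OF _ mu, of y z] by (simp add: cdf)
    let ?J = "{..<n} - I"
    have mono: "P {..<n} y \<le> P K y" if "K \<subseteq> {..<n}" for K y
    proof -
      have "finite K" using that finite_subset by blast
      then have "{\<omega> \<in> space M. \<forall>i\<in>K. X i \<omega> \<le> y i} \<in> sets M"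
        using that by (intro sets.sets_Collect_finite_All) (auto intro!: borel_measurable_le X')
      then show ?thesis
        unfolding P_def using that by (intro finite_measure_mono) auto
    qed
    have Ppos: "0 < P K y" if "K \<subseteq> {..<n}" "\<forall>i<n. 0 < y i" for K y
      using pos[OF _ mu, of y] mono[OF that(1), of y] that(2) by (simp add: cdf)
    have b: "\<forall>i<n. 0 < b i" using x by force
    have x0: "\<forall>i<n. 0 < x i" using x by simp
    have IJ: "I \<subseteq> {..<n}" "?J \<subseteq> {..<n}" using I by auto
    have ratio: "P K y * P {..<n} (\<lambda>i. if i \<in> K then z i else c i) \<le>
        P K z * P {..<n} (\<lambda>i. if i \<in> K then y i else c i)"
      if "K \<subseteq> {..<n}" "\<And>i. i \<in> K \<Longrightarrow> y i \<le> z i" for K and y z c :: "nat \<Rightarrow> real"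
      unfolding P_def
      by (rule cdf_marginal_ratio_mono[OF M X' that(1)]) (use mtp2' that(2) in \<open>auto simp: P_def\<close>)
    (* the path from x to b changes the coordinates in I first *)
    define v where "v i = (if i \<in> I then b i else x i)" for i
    have v: "P {..<n} (\<lambda>i. if i \<in> ?J then x i else b i) = P {..<n} v"
      unfolding P_def v_def using IJ by (intro arg_cong[where f="measure M"]) force
    have e: "(\<lambda>i. if i \<in> K then y i else y i) = y" for K and y :: "nat \<Rightarrow> real" by auto
    have r1: "P I x * P {..<n} v \<le> P I b * P {..<n} x"
      using ratio[OF IJ(1), of x b x] x IJ(1) unfolding e v_def by force
    have r2: "P ?J x * P {..<n} b \<le> P ?J b * P {..<n} v"
      using ratio[OF IJ(2), of x b b] x unfolding e v by force
    have "P {..<n} b * (P I x * P ?J x) = P I x * (P ?J x * P {..<n} b)" by (simp add: mult_ac)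
    also have "\<dots> \<le> P I x * (P ?J b * P {..<n} v)"
      using r2 by (intro mult_left_mono) (auto simp: P_def)
    also have "\<dots> = P ?J b * (P I x * P {..<n} v)" by (simp add: mult_ac)
    also have "\<dots> \<le> P ?J b * (P I b * P {..<n} x)"
      using r1 by (intro mult_left_mono) (auto simp: P_def)
    finally have "P {..<n} b * (P I x * P ?J x) \<le> P {..<n} x * (P I b * P ?J b)" by (simp add: mult_ac)
    then have "P {..<n} b / (P I b * P ?J b) \<le> P {..<n} x / (P I x * P ?J x)"
      using Ppos[OF IJ(1) x0] Ppos[OF IJ(2) x0] Ppos[OF IJ(1) b] Ppos[OF IJ(2) b]
      by (simp add: pos_divide_le_eq pos_le_divide_eq mult_ac)
    moreover have "(\<Inter>i\<in>K. {\<omega> \<in> space M. X i \<omega> \<le> y i}) = {\<omega> \<in> space M. \<forall>i\<in>K. X i \<omega> \<le> y i}"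
      if "K \<noteq> {}" for K y
      using that by auto
    moreover have "{..<n} \<noteq> {}" "?J \<noteq> {}" using I by auto
    ultimately show ?thesis using I(1) by (simp add: P_def)
  qed
  show ?thesis
    unfolding Let_def using 1 2 by blast
qed

end
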